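(* Let $\alpha,\beta>0$ with $\alpha<\frac12$, let $\lambda(z)=\beta+\alpha z$, and let $N_t$ be the self-exciting point process with rate function $\lambda$ and initial condition $\gamma\ge 0$. Then $$\frac{N_t-\frac{\beta}{1-\alpha}t}{\sqrt t}\to N\left(0,\frac{\beta}{(1-2\alpha)(1-\alpha)}\right)$$ in distribution as $t\to\infty$, where $N(0,\sigma^2)$ denotes the centered normal distribution with variance $\sigma^2$.
   Context: Model: given $\lambda:\mathbb{R}_{\ge 0}\to\mathbb{R}_{\ge 0}$ and $\gamma\ge 0$, $N_t$ is a simple point process on $(0,\infty)$ with $N_0=0$ (empty past history) whose intensity at time $t$ with respect to its natural filtration is $\lambda_t=\lambda\left(\frac{N_{t-}+\gamma}{t+1}\right)$. *)

theory Defs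
  imports "HOL-Probability.Probability"
begin

text \<open>
  A simple point process on the open half-line is represented by its random set of points:
  a random subset \<open>X \<omega>\<close> of \<open>(0, \<infinity>)\<close>, finite on bounded sets, all of whose counting
  variables are measurable.  Points have no multiplicity, and there are none at or before time 0.
\<close>

definition counting :: "('a \<Rightarrow> real set) \<Rightarrow> real \<Rightarrow> 'a \<Rightarrow> nat" where
  "counting X t \<omega> = card (X \<omega> \<inter> {0<..t})"

definition simple_point_process :: "'a measure \<Rightarrow> ('a \<Rightarrow> real set) \<Rightarrow> bool" where
  "simple_point_process M X \<longleftrightarrow>
     (\<forall>\<omega>\<in>space M. X \<omega> \<subseteq> {0<..} \<and> (\<forall>t. finite (X \<omega> \<inter> {0<..t}))) \<and>
     (\<forall>t. counting X t \<in> M \<rightarrow>\<^sub>M count_space UNIV)"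

definition counting_left :: "('a \<Rightarrow> real set) \<Rightarrow> real \<Rightarrow> 'a \<Rightarrow> real" where
  "counting_left X t \<omega> = Lim (at_left t) (\<lambda>s. real (counting X s \<omega>))"

definition natural_filtration :: "'a measure \<Rightarrow> ('a \<Rightarrow> real set) \<Rightarrow> real \<Rightarrow> 'a measure" where
  "natural_filtration M X t =
     sigma (space M) {counting X s -` B \<inter> space M | s B. 0 \<le> s \<and> s \<le> t}"

definition predictable_sigma :: "'a measure \<Rightarrow> (real \<Rightarrow> 'a measure) \<Rightarrow> (real \<times> 'a) measure" where
  "predictable_sigma M F =
     sigma ({0<..} \<times> space M) {{a<..b} \<times> A | a b A. 0 \<le> a \<and> a \<le> b \<and> A \<in> sets (F a)}"

definition progressive :: "(real \<Rightarrow> 'a measure) \<Rightarrow> (real \<Rightarrow> 'a \<Rightarrow> real) \<Rightarrow> bool" where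
  "progressive F Y \<longleftrightarrow>
     (\<forall>t\<ge>0. (\<lambda>(s, \<omega>). Y s \<omega>) \<in> borel_measurable (restrict_space borel {0..t} \<Otimes>\<^sub>M F t))"

text \<open>
  Stochastic intensity in the sense of Bremaud: \<open>L\<close> is a nonnegative progressive process,
  almost surely locally integrable in time, with
  \<open>E (\<integral> C\<^sub>s dN\<^sub>s) = E (\<integral> C\<^sub>s L\<^sub>s ds)\<close>
  for all nonnegative predictable \<open>C\<close>.  The integral against \<open>dN\<close> is the sum
  over the points, i.e. the integral with respect to the counting measure on \<open>X \<omega>\<close>.
  Requiring only \<open>E (N\<^sub>b - N\<^sub>a | F\<^sub>a) = E (\<integral>\<^sub>a\<^sup>b L\<^sub>s ds | F\<^sub>a)\<close>
  would be too weak here: without integrability of \<open>N\<close>, both sides may be infinite.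
\<close>

definition has_intensity ::
  "'a measure \<Rightarrow> (real \<Rightarrow> 'a measure) \<Rightarrow> ('a \<Rightarrow> real set) \<Rightarrow> (real \<Rightarrow> 'a \<Rightarrow> real) \<Rightarrow> bool" where
  "has_intensity M F X L \<longleftrightarrow>
     filtration (space M) F \<and> (\<forall>t. subalgebra M (F t)) \<and>
     (\<forall>t\<ge>0. counting X t \<in> F t \<rightarrow>\<^sub>M count_space UNIV) \<and>
     (\<forall>t\<ge>0. \<forall>\<omega>\<in>space M. 0 \<le> L t \<omega>) \<and>
     progressive F L \<and>
     (\<forall>t\<ge>0. AE \<omega> in M. (\<integral>\<^sup>+s\<in>{0..t}. ennreal (L s \<omega>) \<partial>lborel) < \<infinity>) \<and>
     (\<forall>C \<in> predictable_sigma M F \<rightarrow>\<^sub>M (borel :: ennreal measure).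
        (\<integral>\<^sup>+\<omega>. (\<integral>\<^sup>+s. C (s, \<omega>) \<partial>count_space (X \<omega>)) \<partial>M) =
        (\<integral>\<^sup>+\<omega>. (\<integral>\<^sup>+s\<in>{0<..}. C (s, \<omega>) * ennreal (L s \<omega>) \<partial>lborel) \<partial>M))"

definition self_exciting_process ::
  "'a measure \<Rightarrow> (real \<Rightarrow> real) \<Rightarrow> real \<Rightarrow> ('a \<Rightarrow> real set) \<Rightarrow> bool" where
  "self_exciting_process M rate \<gamma> X \<longleftrightarrow>
     simple_point_process M X \<and>
     has_intensity M (natural_filtration M X) X
       (\<lambda>t \<omega>. rate ((counting_left X t \<omega> + \<gamma>) / (t + 1)))"

text \<open>\<^const>\<open>weak_conv_m\<close> covers sequences only; this is the same notion along a filter.\<close>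

definition weak_conv_along :: "('i \<Rightarrow> real measure) \<Rightarrow> real measure \<Rightarrow> 'i filter \<Rightarrow> bool" where
  "weak_conv_along m \<mu> G \<longleftrightarrow>
     (\<forall>x. isCont (cdf \<mu>) x \<longrightarrow> ((\<lambda>i. cdf (m i) x) \<longlongrightarrow> cdf \<mu> x) G)"

lemma weak_conv_along_sequentially: "weak_conv_along m \<mu> sequentially \<longleftrightarrow> weak_conv_m m \<mu>"
  by (simp add: weak_conv_along_def weak_conv_m_def weak_conv_def)

lemma counting_0: "counting X 0 \<omega> = 0"
  by (simp add: counting_def)

lemma counting_left_eq:
  assumes "simple_point_process M X" "\<omega> \<in> space M"
  shows "counting_left X t \<omega> = real (card (X \<omega> \<inter> {0<..<t}))"
proof -
  have fin: "finite (X \<omega> \<inter> {0<..<t})"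
    using assms by (auto simp: simple_point_process_def intro: rev_finite_subset[of "X \<omega> \<inter> {0<..t}"])
  define u where "u = Max (insert (t - 1) (X \<omega> \<inter> {0<..<t}))"
  have u: "u < t"
    unfolding u_def using fin by (subst Max_less_iff) auto
  have le: "x \<le> u" if "x \<in> X \<omega>" "0 < x" "x < t" for x
    unfolding u_def using fin that by (intro Max_ge) auto
  have "counting X s \<omega> = card (X \<omega> \<inter> {0<..<t})" if "u < s" "s < t" for s
  proof -
    have "X \<omega> \<inter> {0<..s} = X \<omega> \<inter> {0<..<t}"
      using le that by force
    then show ?thesis by (simp add: counting_def)
  qed
  then have "\<forall>\<^sub>F s in at_left t. real (counting X s \<omega>) = real (card (X \<omega> \<inter> {0<..<t}))"
    using u by (auto simp: eventually_at_left)
  then have "((\<lambda>s. real (counting X s \<omega>)) \<longlongrightarrow> real (card (X \<omega> \<inter> {0<..<t}))) (at_left t)"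
    by (rule tendsto_eventually)
  then show ?thesis
    unfolding counting_left_def by (intro tendsto_Lim) simp_all
qed

lemma sets_natural_filtration:
  "sets (natural_filtration M X t) =
     sigma_sets (space M) {counting X s -` B \<inter> space M | s B. 0 \<le> s \<and> s \<le> t}"
  unfolding natural_filtration_def by (rule sets_measure_of) blast

lemma space_natural_filtration: "space (natural_filtration M X t) = space M"
  unfolding natural_filtration_def by (rule space_measure_of) blast

lemma filtration_natural: "filtration (space M) (natural_filtration M X)"
proof (rule filtration.intro)
  fix i j :: real assume "i \<le> j"
  then show "sets (natural_filtration M X i) \<subseteq> sets (natural_filtration M X j)"
    unfolding sets_natural_filtration by (intro sigma_sets_mono') force
qed (rule space_natural_filtration)

lemma subalgebra_natural:
  assumes "simple_point_process M X"
  shows "subalgebra M (natural_filtration M X t)"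
proof -
  have "counting X s -` B \<inter> space M \<in> sets M" for s B
    using assms by (intro measurable_sets[where A="count_space UNIV"]) (simp_all add: simple_point_process_def)
  then show ?thesis
    unfolding subalgebra_def space_natural_filtration sets_natural_filtration
    by (intro conjI refl sets.sigma_sets_subset) blast
qed

end

theory Submission
  imports Defs "HOL-Real_Asymp.Real_Asymp"
begin

text \<open>
  With a rate that is affine in \<open>N\<close>, the process is a birth process with immigration: each
  point gives birth at rate \<open>\<alpha> / (t + 1)\<close>, and new points immigrate at rate
  \<open>\<beta> + \<alpha> * \<gamma> / (t + 1)\<close>. Hence the backward equation for the generating function has an
  explicit solution, \<open>G ^ n * exp J\<close>, where \<open>G\<close> is the generating function of the descendants
  of one point and \<open>J\<close> is the integral of the immigration rate against \<open>G - 1\<close>.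
  The defining property of the intensity turns this into a formula for \<open>E (z ^ N\<^sub>t)\<close>, first for
  \<open>\<bar>z\<bar> < 1\<close>, where all quantities are bounded and no moment of \<open>N\<^sub>t\<close> is needed, and then by
  continuity for \<open>\<bar>z\<bar> = 1\<close>. Inserting \<open>z = exp (\<i> u / sqrt t)\<close> and expanding \<open>G - 1\<close> to second
  order in \<open>1 / z - 1\<close> gives the limit of the characteristic functions; \<open>\<alpha> < 1 / 2\<close> makes the
  second order term of size 1 and the remainder negligible.
\<close>

section \<open>Sums over the points and their compensators\<close>

text \<open>Its value is the left limit of the count, by \<open>counting_left_eq\<close>; being a
  natural number it can index the functions summed over the points below.\<close>

definition left_count :: "('a \<Rightarrow> real set) \<Rightarrow> real \<Rightarrow> 'a \<Rightarrow> nat" where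
  "left_count X s \<omega> = card (X \<omega> \<inter> {0<..<s})"

text \<open>Between consecutive points of \<open>S\<close> the count is constant, so the fundamental
  theorem of calculus applies to \<open>h\<close> at that fixed count. Each point raises the count
  by one and contributes a jump of \<open>h\<close>. The strict upper bound in
  \<open>{0<..<s}\<close> gives the count just before the jump, which is the one that the intensity
  sees.\<close>

lemma jump_decomposition:
  fixes h g :: "real \<Rightarrow> nat \<Rightarrow> real"
  assumes "finite S" "S \<subseteq> {0<..t}" "0 \<le> t"
    and deriv: "\<And>n s. 0 \<le> s \<Longrightarrow> s \<le> t \<Longrightarrow> ((\<lambda>s. h s n) has_real_derivative g s n) (at s within {0..t})"
  shows "((\<lambda>s. g s (card (S \<inter> {0<..<s}))) has_integral
           (h t (card S) - h 0 0
             - (\<Sum>s\<in>S. h s (Suc (card (S \<inter> {0<..<s}))) - h s (card (S \<inter> {0<..<s}))))) {0..t}"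
proof -
  have ftc: "((\<lambda>s. g s n) has_integral (h b n - h a n)) {a..b}" if "0 \<le> a" "a \<le> b" "b \<le> t" for a b n
    using that by (intro fundamental_theorem_of_calculus)
      (auto simp flip: has_real_derivative_iff_has_vector_derivative intro!: DERIV_subset[OF deriv])
  \<comment> \<open>The upper end \<open>u\<close> is generalized because the induction adds the
    largest point \<open>b\<close>: the hypothesis for \<open>A\<close> is used up to
    \<open>b\<close>, and after \<open>b\<close> the count no longer changes.\<close>
  have "\<forall>u. S \<subseteq> {0<..u} \<longrightarrow> 0 \<le> u \<longrightarrow> u \<le> t \<longrightarrow> ((\<lambda>s. g s (card (S \<inter> {0<..<s}))) has_integral
           (h u (card S) - h 0 0
             - (\<Sum>s\<in>S. h s (Suc (card (S \<inter> {0<..<s}))) - h s (card (S \<inter> {0<..<s}))))) {0..u}"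
    using \<open>finite S\<close>
  proof (induction rule: finite_linorder_max_induct)
    case empty
    then show ?case using ftc[of 0] by auto
  next
    case (insert b A)
    show ?case
    proof (intro allI impI)
      fix u assume u: "insert b A \<subseteq> {0<..u}" "0 \<le> u" "u \<le> t"
      have b: "0 < b" "b \<le> u" "b \<notin> A" using u insert by auto
      have Ab: "A \<subseteq> {0<..b}" using u insert.hyps by force
      have low: "insert b A \<inter> {0<..<s} = A \<inter> {0<..<s}" if "s \<le> b" for s using that by auto
      have high: "card (insert b A \<inter> {0<..<s}) = Suc (card A)" if "b < s" for s
      proof -
        have "insert b A \<inter> {0<..<s} = insert b A" using that insert u by force
        then show ?thesis using insert b by simp
      qed
      have all: "A \<inter> {0<..<b} = A" using insert u by auto
      let ?I = "h b (card A) - h 0 0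
             - (\<Sum>s\<in>A. h s (Suc (card (A \<inter> {0<..<s}))) - h s (card (A \<inter> {0<..<s})))"
      have "((\<lambda>s. g s (card (A \<inter> {0<..<s}))) has_integral ?I) {0..b}"
        using Ab b u by (intro insert.IH[rule_format]) auto
      then have 1: "((\<lambda>s. g s (card (insert b A \<inter> {0<..<s}))) has_integral ?I) {0..b}"
        by (rule has_integral_eq[rotated]) (simp add: low)
      \<comment> \<open>At \<open>b\<close> itself the left count is still \<open>card A\<close>, so
        the integrand agrees with the one at the fixed count \<open>Suc (card A)\<close> except at
        one point.\<close>
      have 2: "((\<lambda>s. g s (card (insert b A \<inter> {0<..<s}))) has_integral
          (h u (Suc (card A)) - h b (Suc (card A)))) {b..u}"
        by (rule has_integral_spike_finite[where S="{b}", OF _ _ ftc]) (use b u high in auto)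
      have "(\<Sum>s\<in>A. h s (Suc (card (insert b A \<inter> {0<..<s}))) - h s (card (insert b A \<inter> {0<..<s})))
          = (\<Sum>s\<in>A. h s (Suc (card (A \<inter> {0<..<s}))) - h s (card (A \<inter> {0<..<s})))"
        using insert by (intro sum.cong refl) (auto simp: low)
      then have eq: "?I + (h u (Suc (card A)) - h b (Suc (card A))) = h u (card (insert b A)) - h 0 0
             - (\<Sum>s\<in>insert b A. h s (Suc (card (insert b A \<inter> {0<..<s}))) - h s (card (insert b A \<inter> {0<..<s})))"
        using insert.hyps(1) b by (simp add: low all del: Int_insert_left)
      show "((\<lambda>s. g s (card (insert b A \<inter> {0<..<s}))) has_integral
          (h u (card (insert b A)) - h 0 0
             - (\<Sum>s\<in>insert b A. h s (Suc (card (insert b A \<inter> {0<..<s}))) - h s (card (insert b A \<inter> {0<..<s})))))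
          {0..u}"
        unfolding eq[symmetric] by (rule has_integral_combine[OF _ _ 1 2]) (use b in auto)
    qed
  qed
  then show ?thesis using assms by auto
qed

section \<open>Predictability and joint measurability of the left count\<close>

text \<open>Any rational \<open>q\<close> strictly between the last point before \<open>s\<close>
  and \<open>s\<close> already sees all points before \<open>s\<close>. This writes the level sets
  of the left count as countable unions of sets that involve the count at a fixed earlier
  time.\<close>

lemma left_count_greater_iff:
  assumes "simple_point_process M X" "\<omega> \<in> space M"
  shows "k < left_count X s \<omega> \<longleftrightarrow> (\<exists>q\<in>\<rat>. 0 \<le> q \<and> q < s \<and> k < counting X q \<omega>)"
proof
  have fin: "finite (X \<omega> \<inter> {0<..u})" for u
    using assms by (auto simp: simple_point_process_def)
  have fin': "finite (X \<omega> \<inter> {0<..<s})" by (rule finite_subset[OF _ fin[of s]]) auto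
  show "k < left_count X s \<omega>" if "\<exists>q\<in>\<rat>. 0 \<le> q \<and> q < s \<and> k < counting X q \<omega>"
  proof -
    from that obtain q where "q < s" "k < counting X q \<omega>" by auto
    moreover have "counting X q \<omega> \<le> left_count X s \<omega>"
      unfolding counting_def left_count_def using \<open>q < s\<close> by (intro card_mono fin') auto
    ultimately show ?thesis by simp
  qed
  assume k: "k < left_count X s \<omega>"
  then have ne: "X \<omega> \<inter> {0<..<s} \<noteq> {}" by (auto simp: left_count_def)
  define m where "m = Max (X \<omega> \<inter> {0<..<s})"
  have m: "m \<in> X \<omega> \<inter> {0<..<s}" unfolding m_def using fin' ne by (rule Max_in)
  then obtain q where q: "q \<in> \<rat>" "m < q" "q < s" using Rats_dense_in_real[of m s] by auto
  have "X \<omega> \<inter> {0<..<s} \<subseteq> X \<omega> \<inter> {0<..q}"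
  proof
    fix x assume x: "x \<in> X \<omega> \<inter> {0<..<s}"
    then have "x \<le> m" unfolding m_def using fin' by (intro Max_ge)
    then show "x \<in> X \<omega> \<inter> {0<..q}" using x q by auto
  qed
  then have "left_count X s \<omega> \<le> counting X q \<omega>"
    unfolding counting_def left_count_def by (intro card_mono fin)
  then show "\<exists>q\<in>\<rat>. 0 \<le> q \<and> q < s \<and> k < counting X q \<omega>"
    using q m k by (intro bexI[of _ q]) auto
qed

text \<open>The space \<open>P\<close> of pairs of a time and an outcome is left open, so that one
  argument serves both the predictable sigma-algebra and the product of \<open>lborel\<close> with
  \<open>M\<close>.\<close>

lemma measurable_left_count:
  assumes X: "simple_point_process M X"
    and snd: "\<And>x. x \<in> space P \<Longrightarrow> snd x \<in> space M"
    and sets: "\<And>q k. 0 \<le> q \<Longrightarrow> {x \<in> space P. q < fst x \<and> k < counting X q (snd x)} \<in> sets P"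
  shows "(\<lambda>x. left_count X (fst x) (snd x)) \<in> P \<rightarrow>\<^sub>M count_space UNIV"
proof -
  have gt: "{x \<in> space P. k < left_count X (fst x) (snd x)} \<in> sets P" for k
  proof -
    have "{x \<in> space P. k < left_count X (fst x) (snd x)} =
        (\<Union>q\<in>\<rat> \<inter> {0..}. {x \<in> space P. q < fst x \<and> k < counting X q (snd x)})"
      using left_count_greater_iff[OF X snd] by auto
    also have "\<dots> \<in> sets P"
      using countable_rat by (intro sets.countable_UN') (auto intro: countable_subset[OF _ countable_rat] sets)
    finally show ?thesis .
  qed
  have "(\<lambda>x. left_count X (fst x) (snd x)) -` {n} \<inter> space P \<in> sets P" for n
  proof (cases n)
    case 0
    have "(\<lambda>x. left_count X (fst x) (snd x)) -` {n} \<inter> space P =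
        space P - {x \<in> space P. 0 < left_count X (fst x) (snd x)}"
      using 0 by auto
    then show ?thesis using gt[of 0] by auto
  next
    case (Suc m)
    have "(\<lambda>x. left_count X (fst x) (snd x)) -` {n} \<inter> space P =
        {x \<in> space P. m < left_count X (fst x) (snd x)} - {x \<in> space P. n < left_count X (fst x) (snd x)}"
      using Suc by auto
    then show ?thesis using gt[of m] gt[of n] by auto
  qed
  then show ?thesis
    by (subst measurable_count_space_eq2_countable) auto
qed

lemma natural_filtration_subset_space: "A \<in> sets (natural_filtration M X t) \<Longrightarrow> A \<subseteq> space M"
  using sets.sets_into_space space_natural_filtration by metis

lemma space_predictable: "space (predictable_sigma M (natural_filtration M X)) = {0<..} \<times> space M"
  unfolding predictable_sigma_def
  by (rule space_measure_of)
    (use natural_filtration_subset_space in fastforce)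

lemma sets_predictableI:
  assumes "0 \<le> a" "a \<le> b" "A \<in> sets (natural_filtration M X a)"
  shows "{a<..b} \<times> A \<in> sets (predictable_sigma M (natural_filtration M X))"
proof -
  have "{{a<..b} \<times> A | a b A. 0 \<le> a \<and> a \<le> b \<and> A \<in> sets (natural_filtration M X a)} \<subseteq> Pow ({0<..} \<times> space M)"
    by (use natural_filtration_subset_space in fastforce)
  then show ?thesis
    unfolding predictable_sigma_def using assms by (auto simp: sets_measure_of)
qed

lemma sets_predictable_greater:
  assumes "0 \<le> a" "A \<in> sets (natural_filtration M X a)"
  shows "{a<..} \<times> A \<in> sets (predictable_sigma M (natural_filtration M X))"
proof -
  have "{a<..} \<times> A = (\<Union>n::nat. {a<..a + real n} \<times> A)"
  proof (intro set_eqI iffI)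
    fix x assume x: "x \<in> {a<..} \<times> A"
    obtain n :: nat where "fst x - a < real n" using reals_Archimedean2 by blast
    then show "x \<in> (\<Union>n::nat. {a<..a + real n} \<times> A)" using x by (auto intro!: exI[of _ n])
  qed auto
  also have "\<dots> \<in> sets (predictable_sigma M (natural_filtration M X))"
    using assms by (intro sets.countable_UN) (auto intro: sets_predictableI)
  finally show ?thesis .
qed

lemma counting_greater_natural:
  "0 \<le> q \<Longrightarrow> q \<le> t \<Longrightarrow> {\<omega> \<in> space M. k < counting X q \<omega>} \<in> sets (natural_filtration M X t)"
  unfolding sets_natural_filtration
  by (intro sigma_sets.Basic) (auto intro!: exI[of _ q] exI[of _ "{k<..}"])

lemma measurable_fst_predictable:
  "fst \<in> predictable_sigma M (natural_filtration M X) \<rightarrow>\<^sub>M (borel :: real measure)"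
proof (rule borel_measurableI_greater)
  fix a :: real
  \<comment> \<open>All times in the space are positive, so a negative level can be raised to 0,
    where the filtration starts.\<close>
  have "fst -` {a<..} \<inter> ({0<..} \<times> space M) = {max a 0<..} \<times> space M" by auto
  also have "fst -` {a<..} \<inter> ({0<..} \<times> space M) =
      {x \<in> space (predictable_sigma M (natural_filtration M X)). a < fst x}"
    by (auto simp: space_predictable)
  finally show "{x \<in> space (predictable_sigma M (natural_filtration M X)). a < fst x}
      \<in> sets (predictable_sigma M (natural_filtration M X))"
    using sets_predictable_greater[of "max a 0" "space M" M X]
      sets.top[of "natural_filtration M X (max a 0)"]
    by (simp add: space_natural_filtration)
qed

lemma measurable_left_count_predictable:
  assumes "simple_point_process M X"
  shows "(\<lambda>x. left_count X (fst x) (snd x)) \<in>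
    predictable_sigma M (natural_filtration M X) \<rightarrow>\<^sub>M count_space UNIV"
proof (rule measurable_left_count[OF assms])
  fix q :: real and k assume q: "0 \<le> q"
  \<comment> \<open>Because the count is read at \<open>q\<close> and used only after
    \<open>q\<close>, the set is a rectangle whose event is known at its left end: exactly a
    predictable set.\<close>
  have "{x \<in> space (predictable_sigma M (natural_filtration M X)). q < fst x \<and> k < counting X q (snd x)} =
      {q<..} \<times> {\<omega> \<in> space M. k < counting X q \<omega>}"
    using q by (auto simp: space_predictable)
  then show "{x \<in> space (predictable_sigma M (natural_filtration M X)). q < fst x \<and> k < counting X q (snd x)}
      \<in> sets (predictable_sigma M (natural_filtration M X))"
    using q by (simp add: sets_predictable_greater counting_greater_natural)
qed (auto simp: space_predictable)

lemma measurable_left_count_pair: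
  assumes "simple_point_process M X"
  shows "(\<lambda>x. left_count X (fst x) (snd x)) \<in> lborel \<Otimes>\<^sub>M M \<rightarrow>\<^sub>M count_space UNIV"
proof (rule measurable_left_count[OF assms])
  fix q :: real and k assume q: "0 \<le> q"
  have [measurable]: "counting X q \<in> M \<rightarrow>\<^sub>M count_space UNIV"
    using assms by (simp add: simple_point_process_def)
  show "{x \<in> space (lborel \<Otimes>\<^sub>M M). q < fst x \<and> k < counting X q (snd x)} \<in> sets (lborel \<Otimes>\<^sub>M M)"
    by measurable
qed (auto simp: space_pair_measure)

section \<open>Sums over points and the intensity identity\<close>

lemma nn_integral_points:
  assumes "finite (X \<inter> {0<..t})" "X \<subseteq> {0<..}" "\<And>s. 0 \<le> f s"
  shows "(\<integral>\<^sup>+s. ennreal (f s) * indicator {..t} s \<partial>count_space X) = ennreal (\<Sum>s\<in>X \<inter> {0<..t}. f s)"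
proof -
  have "(\<integral>\<^sup>+s. ennreal (f s) * indicator {..t} s \<partial>count_space X) =
      (\<Sum>s\<in>X \<inter> {0<..t}. ennreal (f s) * indicator {..t} s)"
    using assms by (intro nn_integral_count_space') (auto simp: indicator_def)
  also have "\<dots> = (\<Sum>s\<in>X \<inter> {0<..t}. ennreal (f s))"
    by (intro sum.cong) auto
  finally show ?thesis using assms by (simp add: sum_ennreal)
qed

text \<open>This is the defining identity of the intensity for the predictable integrand
  \<open>C\<close>, that is, \<open>f\<close> at the left count, cut off after \<open>t\<close>.
  Both sides may still be infinite here; finiteness comes from the growth bound below.\<close>

lemma intensity_formula:
  assumes proc: "self_exciting_process M rate \<gamma> X"
    and [measurable]: "\<And>n. f n \<in> borel_measurable borel" and nn: "\<And>n s. 0 \<le> f n s"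
    and rate: "\<And>z. 0 \<le> z \<Longrightarrow> 0 \<le> rate z" and "0 \<le> \<gamma>"
  shows "(\<integral>\<^sup>+\<omega>. ennreal (\<Sum>s\<in>X \<omega> \<inter> {0<..t}. f (left_count X s \<omega>) s) \<partial>M) =
    (\<integral>\<^sup>+\<omega>. (\<integral>\<^sup>+s. ennreal (indicator {0<..t} s * (f (left_count X s \<omega>) s
        * rate ((real (left_count X s \<omega>) + \<gamma>) / (s + 1)))) \<partial>lborel) \<partial>M)"
proof -
  have X: "simple_point_process M X" using proc by (simp add: self_exciting_process_def)
  define C where "C x = ennreal (f (left_count X (fst x) (snd x)) (fst x)) * indicator {..t} (fst x)" for x
  note [measurable] = measurable_fst_predictable[of M X] measurable_left_count_predictable[OF X]
  have [measurable]: "(\<lambda>x. f (left_count X (fst x) (snd x)) (fst x)) \<in>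
      borel_measurable (predictable_sigma M (natural_filtration M X))"
    by (rule measurable_compose_countable[where g="\<lambda>x. left_count X (fst x) (snd x)" and f="\<lambda>n x. f n (fst x)"])
      measurable
  have C: "C \<in> predictable_sigma M (natural_filtration M X) \<rightarrow>\<^sub>M borel"
    unfolding C_def by measurable
  have left: "counting_left X t \<omega> = real (left_count X t \<omega>)" if "\<omega> \<in> space M" for t \<omega>
    using counting_left_eq[OF X that] by (simp add: left_count_def)
  have "(\<integral>\<^sup>+\<omega>. ennreal (\<Sum>s\<in>X \<omega> \<inter> {0<..t}. f (left_count X s \<omega>) s) \<partial>M) =
      (\<integral>\<^sup>+\<omega>. (\<integral>\<^sup>+s. C (s, \<omega>) \<partial>count_space (X \<omega>)) \<partial>M)"
    using X nn unfolding C_def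
    by (intro nn_integral_cong) (auto simp: simple_point_process_def intro!: nn_integral_points[symmetric])
  also have "\<dots> = (\<integral>\<^sup>+\<omega>. (\<integral>\<^sup>+s\<in>{0<..}. C (s, \<omega>) *
      ennreal (rate ((counting_left X s \<omega> + \<gamma>) / (s + 1))) \<partial>lborel) \<partial>M)"
    using proc C unfolding self_exciting_process_def has_intensity_def by blast
  also have "\<dots> = (\<integral>\<^sup>+\<omega>. (\<integral>\<^sup>+s. ennreal (indicator {0<..t} s * (f (left_count X s \<omega>) s
        * rate ((real (left_count X s \<omega>) + \<gamma>) / (s + 1)))) \<partial>lborel) \<partial>M)"
    using nn rate \<open>0 \<le> \<gamma>\<close>
    by (intro nn_integral_cong) (auto simp: C_def left indicator_def ennreal_mult)
  finally show ?thesis .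
qed

text \<open>The jump decomposition is applied to \<open>harm n\<close>, which does not depend on
  time, so the integral vanishes and only jumps remain: the k-th point has k - 1 predecessors and
  contributes 1 / k. Thus this sum is a function of the count alone.\<close>

lemma sum_points_inverse:
  fixes S :: "real set"
  assumes "finite S" "S \<subseteq> {0<..t}" "0 \<le> t"
  shows "(\<Sum>s\<in>S. 1 / (real (card (S \<inter> {0<..<s})) + 1)) = harm (card S)"
proof -
  have "((\<lambda>s. 0::real) has_integral (harm (card S) - harm 0
      - (\<Sum>s\<in>S. harm (Suc (card (S \<inter> {0<..<s}))) - harm (card (S \<inter> {0<..<s}))))) {0..t}"
    by (rule jump_decomposition[OF assms]) auto
  then have "harm (card S) - harm 0
      - (\<Sum>s\<in>S. harm (Suc (card (S \<inter> {0<..<s}))) - harm (card (S \<inter> {0<..<s}))) = (0::real)"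
    by (rule has_integral_unique) simp
  then show ?thesis by (simp add: harm_Suc harm_def[of 0] inverse_eq_divide add.commute)
qed

section \<open>Dynkin's formula under linear growth of the rate\<close>

locale linear_growth_process = prob_space M
  for M :: "'a measure" and X :: "'a \<Rightarrow> real set" and rate :: "real \<Rightarrow> real" and \<gamma> :: real +
  fixes B :: real
  assumes proc: "self_exciting_process M rate \<gamma> X"
    and \<gamma>: "0 \<le> \<gamma>"
    and rate_meas [measurable]: "rate \<in> borel_measurable borel"
    and rate_nonneg: "\<And>z. 0 \<le> z \<Longrightarrow> 0 \<le> rate z"
    and rate_le: "\<And>z. 0 \<le> z \<Longrightarrow> rate z \<le> B * (1 + z)"
begin

lemma X: "simple_point_process M X"
  using proc by (simp add: self_exciting_process_def)

lemma finite_points: "\<omega> \<in> space M \<Longrightarrow> finite (X \<omega> \<inter> {0<..t})"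
  using X by (simp add: simple_point_process_def)

lemma counting_measurable [measurable]: "counting X t \<in> M \<rightarrow>\<^sub>M count_space UNIV"
  using X by (simp add: simple_point_process_def)

text \<open>Since \<open>s + 1\<close> is at least 1, the division only helps, and the bound is
  uniform in time. The factor \<open>real n + 1\<close> is the weight against which the summands
  \<open>f\<close> are measured below.\<close>

lemma rate_bound:
  assumes "0 \<le> s"
  shows "rate ((real n + \<gamma>) / (s + 1)) \<le> B * (1 + \<gamma>) * (real n + 1)"
proof -
  have B: "0 \<le> B" using rate_nonneg[of 0] rate_le[of 0] by simp
  have "rate ((real n + \<gamma>) / (s + 1)) \<le> B * (1 + (real n + \<gamma>) / (s + 1))"
    using assms \<gamma> by (intro rate_le) simp
  also have "\<dots> \<le> B * (1 + (real n + \<gamma>))"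
    using assms \<gamma> B by (intro mult_left_mono add_left_mono) (simp_all add: divide_le_eq mult_le_cancel_left1)
  also have "\<dots> \<le> B * ((1 + \<gamma>) * (real n + 1))"
    using \<gamma> B by (intro mult_left_mono) (simp_all add: algebra_simps)
  finally show ?thesis by (simp add: mult_ac)
qed

definition compensator_density :: "(nat \<Rightarrow> real \<Rightarrow> real) \<Rightarrow> real \<Rightarrow> real \<Rightarrow> 'a \<Rightarrow> real" where
  "compensator_density f t s \<omega> = indicator {0<..t} s *
     (f (left_count X s \<omega>) s * rate ((real (left_count X s \<omega>) + \<gamma>) / (s + 1)))"

lemma compensator_density_measurable:
  assumes [measurable]: "\<And>n. f n \<in> borel_measurable borel"
  shows "(\<lambda>x. compensator_density f t (fst x) (snd x)) \<in> borel_measurable (lborel \<Otimes>\<^sub>M M)"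
proof -
  note [measurable] = measurable_left_count_pair[OF X]
  have [measurable]: "(\<lambda>x. f (left_count X (fst x) (snd x)) (fst x)) \<in> borel_measurable (lborel \<Otimes>\<^sub>M M)"
    by (rule measurable_compose_countable[where g="\<lambda>x. left_count X (fst x) (snd x)" and f="\<lambda>n x. f n (fst x)"])
      measurable
  show ?thesis unfolding compensator_density_def by measurable
qed

context
  fixes f :: "nat \<Rightarrow> real \<Rightarrow> real" and t K :: real
  assumes f_meas [measurable]: "\<And>n. f n \<in> borel_measurable borel"
    and f_nonneg: "\<And>n s. 0 \<le> f n s"
    and f_bound: "\<And>n s. (real n + 1) * f n s \<le> K"
    and t: "0 \<le> t"
begin

lemma compensator_density_nonneg: "0 \<le> compensator_density f t s \<omega>"
  using f_nonneg \<gamma> by (auto simp: compensator_density_def indicator_def intro!: mult_nonneg_nonneg rate_nonneg)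

text \<open>The assumption \<open>f_bound\<close> makes \<open>f n s\<close> of order
  \<open>1 / (n + 1)\<close>, which cancels the linear growth of the rate. The density is therefore
  bounded by a constant, with no moment of the count involved.\<close>

lemma compensator_density_bound: "compensator_density f t s \<omega> \<le> B * (1 + \<gamma>) * K * indicator {0..t} s"
proof (cases "s \<in> {0<..t}")
  case True
  let ?n = "left_count X s \<omega>"
  have B: "0 \<le> B" using rate_nonneg[of 0] rate_le[of 0] by simp
  have "f ?n s * rate ((real ?n + \<gamma>) / (s + 1)) \<le> f ?n s * (B * (1 + \<gamma>) * (real ?n + 1))"
    using True by (intro mult_left_mono rate_bound f_nonneg) auto
  also have "\<dots> = B * (1 + \<gamma>) * ((real ?n + 1) * f ?n s)" by (simp add: mult_ac)
  also have "\<dots> \<le> B * (1 + \<gamma>) * K" using B \<gamma> by (intro mult_left_mono f_bound) auto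
  finally show ?thesis using True by (simp add: compensator_density_def)
next
  case False
  have B: "0 \<le> B" using rate_nonneg[of 0] rate_le[of 0] by simp
  have "0 \<le> K" using f_bound[of 0 0] f_nonneg[of 0 0] by simp
  then show ?thesis using False B \<gamma> by (auto simp: compensator_density_def indicator_def)
qed

lemma compensator_density_integrable:
  assumes "\<omega> \<in> space M"
  shows "integrable lborel (\<lambda>s. compensator_density f t s \<omega>)"
proof (rule Bochner_Integration.integrable_bound)
  show "integrable lborel (\<lambda>s. B * (1 + \<gamma>) * K * indicator {0..t} s)"
    using t by (intro integrable_mult_right integrable_real_indicator) auto
  show "(\<lambda>s. compensator_density f t s \<omega>) \<in> borel_measurable lborel"
    using measurable_compose[OF measurable_Pair2'[OF assms] compensator_density_measurable[OF f_meas]] by simp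
  show "AE s in lborel. norm (compensator_density f t s \<omega>) \<le> norm (B * (1 + \<gamma>) * K * indicator {0..t} s)"
    using compensator_density_nonneg compensator_density_bound by (auto intro!: AE_I2 order.trans[OF _ abs_ge_self])
qed

lemma integral_compensator_density_measurable:
  "(\<lambda>\<omega>. LINT s|lborel. compensator_density f t s \<omega>) \<in> borel_measurable M"
proof (rule lborel.borel_measurable_lebesgue_integral)
  show "(\<lambda>(\<omega>, s). compensator_density f t s \<omega>) \<in> borel_measurable (M \<Otimes>\<^sub>M lborel)"
    using measurable_compose[OF measurable_pair_swap' compensator_density_measurable[OF f_meas]]
    by (simp add: case_prod_beta')
qed

lemma integral_compensator_density_le:
  assumes "\<omega> \<in> space M"
  shows "(LINT s|lborel. compensator_density f t s \<omega>) \<le> B * (1 + \<gamma>) * K * t"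
proof -
  have "(LINT s|lborel. compensator_density f t s \<omega>) \<le> (LINT s|lborel. B * (1 + \<gamma>) * K * indicator {0..t} s)"
    using t by (intro integral_mono compensator_density_integrable[OF assms] integrable_mult_right integrable_real_indicator)
      (auto simp: compensator_density_bound)
  then show ?thesis using t by simp
qed

lemma integrable_integral_compensator_density: "integrable M (\<lambda>\<omega>. LINT s|lborel. compensator_density f t s \<omega>)"
proof (rule integrable_const_bound)
  show "AE \<omega> in M. norm (LINT s|lborel. compensator_density f t s \<omega>) \<le> B * (1 + \<gamma>) * K * t"
    using integral_compensator_density_le by (auto intro!: AE_I2 simp: Bochner_Integration.integral_nonneg compensator_density_nonneg)
qed (rule integral_compensator_density_measurable)

text \<open>The compensator is bounded, so the common value in \<open>intensity_formula\<close> is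
  finite. Integrability of the sum over the points is thus obtained together with its
  expectation.\<close>

lemma expectation_points:
  assumes [measurable]: "(\<lambda>\<omega>. \<Sum>s\<in>X \<omega> \<inter> {0<..t}. f (left_count X s \<omega>) s) \<in> borel_measurable M"
  shows "integrable M (\<lambda>\<omega>. \<Sum>s\<in>X \<omega> \<inter> {0<..t}. f (left_count X s \<omega>) s)"
    and "expectation (\<lambda>\<omega>. \<Sum>s\<in>X \<omega> \<inter> {0<..t}. f (left_count X s \<omega>) s) =
      expectation (\<lambda>\<omega>. LINT s|lborel. compensator_density f t s \<omega>)"
proof -
  let ?S = "\<lambda>\<omega>. \<Sum>s\<in>X \<omega> \<inter> {0<..t}. f (left_count X s \<omega>) s"
  let ?I = "\<lambda>\<omega>. LINT s|lborel. compensator_density f t s \<omega>"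
  have I_nonneg: "0 \<le> ?I \<omega>" for \<omega> by (simp add: Bochner_Integration.integral_nonneg compensator_density_nonneg)
  have S_nonneg: "0 \<le> ?S \<omega>" for \<omega> by (simp add: sum_nonneg f_nonneg)
  have "(\<integral>\<^sup>+\<omega>. ennreal (?S \<omega>) \<partial>M) = (\<integral>\<^sup>+\<omega>. (\<integral>\<^sup>+s. ennreal (compensator_density f t s \<omega>) \<partial>lborel) \<partial>M)"
    unfolding compensator_density_def by (rule intensity_formula[OF proc f_meas f_nonneg rate_nonneg \<gamma>])
  also have "\<dots> = (\<integral>\<^sup>+\<omega>. ennreal (?I \<omega>) \<partial>M)"
    by (intro nn_integral_cong nn_integral_eq_integral compensator_density_integrable) (auto simp: compensator_density_nonneg)
  also have "\<dots> = ennreal (expectation ?I)"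
    by (intro nn_integral_eq_integral integrable_integral_compensator_density) (auto simp: I_nonneg)
  finally have *: "(\<integral>\<^sup>+\<omega>. ennreal (?S \<omega>) \<partial>M) = ennreal (expectation ?I)" .
  show "integrable M ?S"
    by (rule integrableI_nonneg) (simp_all add: S_nonneg *)
  show "expectation ?S = expectation ?I"
    by (subst integral_eq_nn_integral)
      (simp_all add: S_nonneg * Bochner_Integration.integral_nonneg I_nonneg)
qed

end

text \<open>
  The jumps of \<open>h\<close> have no sign, so \<open>K / (n + 1)\<close> is added to them: the sum of these
  terms over the points up to time \<open>t\<close> is \<open>K\<close> times the harmonic number of \<open>N\<^sub>t\<close>, which is
  integrable because the linear growth of the rate cancels against \<open>1 / (n + 1)\<close>.
\<close>

lemma dynkin:
  fixes h :: "real \<Rightarrow> nat \<Rightarrow> real"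
  assumes t: "0 \<le> t"
    and deriv: "\<And>n s. 0 \<le> s \<Longrightarrow> s \<le> t \<Longrightarrow> ((\<lambda>s. h s n) has_real_derivative
        - (rate ((real n + \<gamma>) / (s + 1)) * (h s (Suc n) - h s n))) (at s within {0..t})"
    and bound: "\<And>n s. 0 \<le> s \<Longrightarrow> s \<le> t \<Longrightarrow> (real n + 1) * \<bar>h s (Suc n) - h s n\<bar> \<le> K"
  shows "integrable M (\<lambda>\<omega>. h t (counting X t \<omega>))" "expectation (\<lambda>\<omega>. h t (counting X t \<omega>)) = h 0 0"
proof -
  define D where "D n s = h s (Suc n) - h s n" for s n
  \<comment> \<open>The derivative and the bound of \<open>h\<close> are known on
    \<open>{0..t}\<close> only; the indicator turns the continuous function there into a Borel
    function on the whole line.\<close>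
  define f where "f n s = indicator {0..t} s * (D n s + K / (real n + 1))" for n s
  define f' where "f' n s = indicator {0..t} s * (K / (real n + 1))" for n :: nat and s
  have K: "0 \<le> K" using bound[of 0 0] t by simp
  have D: "\<bar>D n s\<bar> \<le> K / (real n + 1)" if "0 \<le> s" "s \<le> t" for n s
    using bound[OF that, of n] by (simp add: D_def field_simps)
  have cont: "continuous_on {0..t} (\<lambda>s. h s n)" for n
    using deriv by (auto intro!: DERIV_continuous_on)
  have "continuous_on {0..t} (\<lambda>s. D n s + K / (real n + 1))" for n
    unfolding D_def by (intro continuous_intros cont)
  then have f_meas: "f n \<in> borel_measurable borel" for n
    using borel_measurable_continuous_on_indicator[of "{0..t}" "\<lambda>s. D n s + K / (real n + 1)"]
    by (simp add: f_def[abs_def])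
  have f'_meas: "f' n \<in> borel_measurable borel" for n
    unfolding f'_def by measurable
  have f_nonneg: "0 \<le> f n s" for n s
    using D[of s n] by (auto simp: f_def indicator_def)
  have f'_nonneg: "0 \<le> f' n s" for n s
    using K by (auto simp: f'_def indicator_def)
  have f_bound: "(real n + 1) * f n s \<le> 2 * K" for n s
  proof (cases "s \<in> {0..t}")
    case True
    then have "(real n + 1) * f n s \<le> (real n + 1) * (2 * (K / (real n + 1)))"
      using D[of s n] by (intro mult_left_mono) (auto simp: f_def)
    then show ?thesis by simp
  qed (simp add: f_def K)
  have f'_bound: "(real n + 1) * f' n s \<le> K" for n s
    using K by (auto simp: f'_def indicator_def)
  note 1 = f_meas f_nonneg f_bound t
  note 2 = f'_meas f'_nonneg f'_bound t

  let ?S = "\<lambda>\<omega>. \<Sum>s\<in>X \<omega> \<inter> {0<..t}. f (left_count X s \<omega>) s"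
  let ?S' = "\<lambda>\<omega>. \<Sum>s\<in>X \<omega> \<inter> {0<..t}. f' (left_count X s \<omega>) s"
  let ?I = "\<lambda>\<omega>. LINT s|lborel. compensator_density f t s \<omega>"
  let ?I' = "\<lambda>\<omega>. LINT s|lborel. compensator_density f' t s \<omega>"
  have card_eq: "card (X \<omega> \<inter> {0<..t} \<inter> {0<..<s}) = left_count X s \<omega>" if "s \<le> t" for s \<omega>
    using that unfolding left_count_def by (intro arg_cong[where f=card]) auto
  \<comment> \<open>This is the formula along a single path: initial value plus jumps minus
    compensator. The added term \<open>K / (n + 1)\<close> cancels in \<open>?S - ?S'\<close> and
    again in \<open>?I - ?I'\<close>.\<close>
  have path: "h t (counting X t \<omega>) = h 0 0 + (?S \<omega> - ?S' \<omega>) - (?I \<omega> - ?I' \<omega>)" if "\<omega> \<in> space M" for \<omega>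
  proof -
    let ?Y = "X \<omega> \<inter> {0<..t}"
    let ?g = "\<lambda>s. - (rate ((real (left_count X s \<omega>) + \<gamma>) / (s + 1)) * D (left_count X s \<omega>) s)"
    have sum: "(\<Sum>s\<in>?Y. h s (Suc (card (?Y \<inter> {0<..<s}))) - h s (card (?Y \<inter> {0<..<s}))) = ?S \<omega> - ?S' \<omega>"
      unfolding sum_subtractf[symmetric]
      by (intro sum.cong refl) (auto simp: f_def f'_def D_def card_eq)
    have "((\<lambda>s. - (rate ((real (card (?Y \<inter> {0<..<s})) + \<gamma>) / (s + 1)) *
         (h s (Suc (card (?Y \<inter> {0<..<s}))) - h s (card (?Y \<inter> {0<..<s}))))) has_integral
         (h t (card ?Y) - h 0 0 - (?S \<omega> - ?S' \<omega>))) {0..t}"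
      unfolding sum[symmetric]
      by (rule jump_decomposition[OF finite_points[OF that] _ t deriv]) auto
    then have g: "(?g has_integral (h t (card ?Y) - h 0 0 - (?S \<omega> - ?S' \<omega>))) {0..t}"
      by (rule has_integral_eq[rotated]) (auto simp: card_eq D_def)
    have "((\<lambda>s. compensator_density f t s \<omega> - compensator_density f' t s \<omega>) has_integral (?I \<omega> - ?I' \<omega>)) UNIV"
      by (intro has_integral_diff has_integral_integral_lborel compensator_density_integrable[OF 1 that]
          compensator_density_integrable[OF 2 that])
    \<comment> \<open>The compensator density lives on the half-open interval, so the two integrands
      can differ only at 0.\<close>
    then have "((\<lambda>s. if s \<in> {0..t} then - ?g s else 0) has_integral (?I \<omega> - ?I' \<omega>)) UNIV"
      by (rule has_integral_spike_finite[where S="{0}", rotated 2])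
        (auto simp: compensator_density_def f_def f'_def algebra_simps)
    then have "((\<lambda>s. - ?g s) has_integral (?I \<omega> - ?I' \<omega>)) {0..t}"
      by (simp only: has_integral_restrict_UNIV)
    from has_integral_neg[OF this] have "(?g has_integral - (?I \<omega> - ?I' \<omega>)) {0..t}" by simp
    from has_integral_unique[OF this g] show ?thesis by (simp add: counting_def)
  qed
  have S': "?S' \<omega> = K * harm (counting X t \<omega>)" if "\<omega> \<in> space M" for \<omega>
  proof -
    have "?S' \<omega> = (\<Sum>s\<in>X \<omega> \<inter> {0<..t}. K * (1 / (real (card (X \<omega> \<inter> {0<..t} \<inter> {0<..<s})) + 1)))"
      by (intro sum.cong refl) (auto simp: f'_def card_eq)
    also have "\<dots> = K * harm (counting X t \<omega>)"
      unfolding sum_distrib_left[symmetric] counting_def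
      using finite_points[OF that] t by (subst sum_points_inverse) auto
    finally show ?thesis .
  qed
  note [measurable] = integral_compensator_density_measurable[OF 1] integral_compensator_density_measurable[OF 2]
  have S'_meas: "?S' \<in> borel_measurable M"
    by (subst measurable_cong[OF S']) measurable
  \<comment> \<open>The path identity is read backwards: it expresses \<open>?S\<close> through the
    count and the integrated densities, whose measurability is known.\<close>
  have S_meas: "?S \<in> borel_measurable M"
  proof (subst measurable_cong)
    show "?S \<omega> = h t (counting X t \<omega>) - h 0 0 + K * harm (counting X t \<omega>) + (?I \<omega> - ?I' \<omega>)"
      if "\<omega> \<in> space M" for \<omega>
      using path[OF that] S'[OF that] by simp
  qed measurable
  note S = expectation_points[OF 1 S_meas] and S'' = expectation_points[OF 2 S'_meas]
  note I = integrable_integral_compensator_density[OF 1] and I' = integrable_integral_compensator_density[OF 2]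
  show "integrable M (\<lambda>\<omega>. h t (counting X t \<omega>))"
    by (subst Bochner_Integration.integrable_cong[OF refl path])
      (auto intro!: Bochner_Integration.integrable_add Bochner_Integration.integrable_diff S(1) S''(1) I I')
  have "expectation (\<lambda>\<omega>. h t (counting X t \<omega>)) =
      expectation (\<lambda>\<omega>. h 0 0 + (?S \<omega> - ?S' \<omega>) - (?I \<omega> - ?I' \<omega>))"
    by (rule Bochner_Integration.integral_cong[OF refl path])
  also have "\<dots> = h 0 0 + (expectation ?S - expectation ?S') - (expectation ?I - expectation ?I')"
    using S(1) S''(1) I I' by (simp add: prob_space)
  finally show "expectation (\<lambda>\<omega>. h t (counting X t \<omega>)) = h 0 0" by (simp add: S(2) S''(2))
qed

end

section \<open>The generating function for an affine rate\<close>

text \<open>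
  \<open>yule_pgf\<close> is the generating function at time \<open>t\<close> of a geometric variable with success
  probability \<open>geom_param\<close>: the law of the descendants of one point born at time \<open>s\<close>, when
  every point gives birth at rate \<open>\<alpha> / (u + 1)\<close> at time \<open>u\<close>.
\<close>

definition geom_param :: "real \<Rightarrow> real \<Rightarrow> real \<Rightarrow> real" where
  "geom_param \<alpha> t s = ((s + 1) / (t + 1)) powr \<alpha>"

definition yule_pgf :: "real \<Rightarrow> real \<Rightarrow> complex \<Rightarrow> real \<Rightarrow> complex" where
  "yule_pgf \<alpha> t z s = z * of_real (geom_param \<alpha> t s) / (1 - (1 - of_real (geom_param \<alpha> t s)) * z)"

lemma geom_param_bounds:
  assumes "0 \<le> s" "s \<le> t" "0 < \<alpha>"
  shows "0 < geom_param \<alpha> t s" "geom_param \<alpha> t s \<le> 1"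
  using assms by (auto simp: geom_param_def intro!: powr_le1)

text \<open>For \<open>p > 0\<close> this keeps the pole of the generating function away from the
  closed unit disc, including the boundary circle where characteristic functions are
  evaluated.\<close>

lemma norm_denominator_ge:
  fixes p :: real and z :: complex
  assumes "p \<le> 1" "norm z \<le> 1"
  shows "p \<le> norm (1 - (1 - of_real p) * z)"
proof -
  have "norm ((1 - of_real p) * z) = (1 - p) * norm z"
    unfolding norm_mult using assms norm_of_real[of "1 - p", where 'a=complex] by (simp del: norm_of_real)
  also have "\<dots> \<le> 1 - p" using assms by (simp add: mult_left_le)
  finally show ?thesis using norm_triangle_ineq2[of 1 "(1 - of_real p) * z"] by simp
qed

context
  fixes \<alpha> t :: real
  assumes \<alpha>: "0 < \<alpha>"
begin

lemma yule_pgf_denominator: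
  assumes "0 \<le> s" "s \<le> t" "norm z \<le> 1"
  shows "1 - (1 - complex_of_real (geom_param \<alpha> t s)) * z \<noteq> 0"
  using norm_denominator_ge[of "geom_param \<alpha> t s" z] geom_param_bounds[OF assms(1,2) \<alpha>] assms by auto

text \<open>Every family contains its founder, so the generating function has a factor
  \<open>z\<close>. The bound by \<open>norm z\<close> instead of 1 gives geometric decay of its
  n-th power inside the disc.\<close>

lemma norm_yule_pgf_le:
  assumes "0 \<le> s" "s \<le> t" "norm z \<le> 1"
  shows "norm (yule_pgf \<alpha> t z s) \<le> norm z"
proof -
  let ?p = "geom_param \<alpha> t s"
  note p = geom_param_bounds[OF assms(1,2) \<alpha>]
  have "?p \<le> norm (1 - (1 - of_real ?p) * z)" using p assms by (intro norm_denominator_ge)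
  then show ?thesis
    using p yule_pgf_denominator[OF assms]
    by (auto simp: yule_pgf_def norm_mult norm_divide divide_le_eq intro!: mult_left_mono)
qed

text \<open>Backward equation of the family of one point: at rate \<open>\<alpha> / (s + 1)\<close>
  one member is replaced by two independent ones, which changes the generating function from
  \<open>G\<close> to \<open>G * G\<close>.\<close>

lemma has_vector_derivative_yule_pgf:
  assumes "0 \<le> s" "s \<le> t" "norm z \<le> 1"
  shows "(yule_pgf \<alpha> t z has_vector_derivative
    - (of_real (\<alpha> / (s + 1)) * yule_pgf \<alpha> t z s * (yule_pgf \<alpha> t z s - 1))) (at s within A)"
proof -
  let ?p = "geom_param \<alpha> t s"
  let ?d = "1 - (1 - complex_of_real ?p) * z"
  have d: "?d \<noteq> 0" by (rule yule_pgf_denominator[OF assms])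
  have "(geom_param \<alpha> t has_real_derivative \<alpha> * ?p / (s + 1)) (at s within A)"
  proof -
    have pos: "0 < s + 1" "0 < t + 1" using assms by auto
    have "(geom_param \<alpha> t has_real_derivative \<alpha> * ((s + 1) / (t + 1)) powr (\<alpha> - 1) * (1 / (t + 1))) (at s within A)"
      unfolding geom_param_def using pos by (auto intro!: derivative_eq_intros)
    then show ?thesis using pos by (simp add: powr_diff geom_param_def)
  qed
  then have p: "((\<lambda>s. complex_of_real (geom_param \<alpha> t s)) has_vector_derivative of_real (\<alpha> * ?p / (s + 1))) (at s within A)"
    unfolding has_real_derivative_iff_has_vector_derivative
    by (rule bounded_linear.has_vector_derivative[OF bounded_linear_of_real])
  have g: "((\<lambda>p. z * p / (1 - (1 - p) * z)) has_field_derivative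
      (z * (1 - z) / ?d\<^sup>2)) (at (of_real ?p) within B)" for B
    using d by (auto intro!: derivative_eq_intros simp: power2_eq_square) (simp add: field_simps)
  have "(yule_pgf \<alpha> t z has_vector_derivative
      of_real (\<alpha> * ?p / (s + 1)) * (z * (1 - z) / ?d\<^sup>2)) (at s within A)"
    using field_vector_diff_chain_within[OF p g] by (simp add: o_def yule_pgf_def[abs_def])
  also have "of_real (\<alpha> * ?p / (s + 1)) * (z * (1 - z) / ?d\<^sup>2) =
      - (of_real (\<alpha> / (s + 1)) * yule_pgf \<alpha> t z s * (yule_pgf \<alpha> t z s - 1))"
  proof -
    have "yule_pgf \<alpha> t z s - 1 = (z - 1) / ?d"
      using d by (simp add: yule_pgf_def field_simps)
    moreover have "a * q * (z * (1 - z) / d\<^sup>2) = - (a * (z * q / d) * ((z - 1) / d))" for a q d :: complex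
      by (cases "d = 0") (simp_all add: field_simps power2_eq_square)
    from this[of "of_real (\<alpha> / (s + 1))" "of_real ?p" ?d]
    have "of_real (\<alpha> * ?p / (s + 1)) * (z * (1 - z) / ?d\<^sup>2) =
        - (of_real (\<alpha> / (s + 1)) * yule_pgf \<alpha> t z s * ((z - 1) / ?d))"
      by (simp add: yule_pgf_def)
    ultimately show ?thesis by simp
  qed
  finally show ?thesis .
qed

lemma continuous_on_yule_pgf:
  "continuous_on (cball 0 1 \<times> {0..t}) (\<lambda>(z, s). yule_pgf \<alpha> t z s)"
proof -
  have "continuous_on (cball 0 1 \<times> {0..t}) (\<lambda>x. complex_of_real (geom_param \<alpha> t (snd x)))"
    unfolding geom_param_def by (intro continuous_intros) auto
  then show ?thesis
    unfolding yule_pgf_def case_prod_beta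
    by (intro continuous_intros) (use yule_pgf_denominator in \<open>auto simp: dist_norm\<close>)
qed

lemma continuous_on_yule_pgf':
  "norm z \<le> 1 \<Longrightarrow> continuous_on {0..t} (yule_pgf \<alpha> t z)"
  by (rule continuous_on_vector_derivative, rule has_vector_derivative_yule_pgf) auto

end

text \<open>For a Poisson stream of immigrants with independent families, the exponential of this
  integral is the generating function of the descendants of those arriving up to \<open>s\<close>.
  The end \<open>s\<close> is separate from the horizon \<open>t\<close> so that a difference of two
  values accounts for arrivals after a given time.\<close>

definition immigration_exponent :: "real \<Rightarrow> real \<Rightarrow> real \<Rightarrow> real \<Rightarrow> complex \<Rightarrow> real \<Rightarrow> complex" where
  "immigration_exponent \<alpha> \<beta> \<gamma> t z s =
     integral {0..s} (\<lambda>u. of_real (\<beta> + \<alpha> * \<gamma> / (u + 1)) * (yule_pgf \<alpha> t z u - 1))"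

lemma immigration_exponent_vector_derivative:
  assumes "0 < \<alpha>" "0 \<le> s" "s \<le> t" "norm z \<le> 1"
  shows "(immigration_exponent \<alpha> \<beta> \<gamma> t z has_vector_derivative
    of_real (\<beta> + \<alpha> * \<gamma> / (s + 1)) * (yule_pgf \<alpha> t z s - 1)) (at s within {0..t})"
  unfolding immigration_exponent_def
  using assms
  by (intro integral_has_vector_derivative continuous_intros continuous_on_yule_pgf') auto

text \<open>The integrand is jointly continuous in \<open>z\<close> and time on a compact set, hence
  the integral is continuous in \<open>z\<close> up to the boundary of the disc.\<close>

lemma continuous_on_immigration_exponent:
  assumes "0 < \<alpha>"
  shows "continuous_on (cball 0 1) (\<lambda>z. immigration_exponent \<alpha> \<beta> \<gamma> t z t)"
proof -
  have "continuous_on (cball 0 1 \<times> {0..t}) (\<lambda>x. yule_pgf \<alpha> t (fst x) (snd x))"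
    using continuous_on_yule_pgf[OF assms] by (simp add: case_prod_beta)
  then have "continuous_on (cball 0 1 \<times> cbox 0 t)
      (\<lambda>(z, u). of_real (\<beta> + \<alpha> * \<gamma> / (u + 1)) * (yule_pgf \<alpha> t z u - 1))"
    unfolding case_prod_beta by (intro continuous_intros) auto
  from integral_continuous_on_param[OF this] show ?thesis
    by (simp add: immigration_exponent_def)
qed

section \<open>Generating function of the count\<close>

locale linear_rate_process = prob_space M
  for M :: "'a measure" and X :: "'a \<Rightarrow> real set" and \<alpha> \<beta> \<gamma> :: real +
  assumes proc: "self_exciting_process M (\<lambda>z. \<beta> + \<alpha> * z) \<gamma> X"
    and \<alpha>: "0 < \<alpha>" and \<beta>: "0 < \<beta>" and \<gamma>: "0 \<le> \<gamma>"
begin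

text \<open>The growth constant comes from expanding \<open>(\<alpha> + \<beta>) * (1 + z)\<close>,
  which contains both \<open>\<beta>\<close> and \<open>\<alpha> * z\<close>.\<close>

sublocale linear_growth_process M X "\<lambda>z. \<beta> + \<alpha> * z" \<gamma> "\<alpha> + \<beta>"
  by unfold_locales (use proc \<alpha> \<beta> \<gamma> in \<open>auto simp: algebra_simps\<close>)

lemma integrable_power_counting:
  fixes z :: complex
  assumes "norm z \<le> 1"
  shows "integrable M (\<lambda>\<omega>. z ^ counting X t \<omega>)"
  by (rule integrable_const_bound[where B=1]) (use assms in \<open>auto simp: norm_power power_le_one\<close>)

text \<open>\<open>dynkin\<close> asks for jumps of order \<open>1 / (n + 1)\<close>. For
  \<open>norm z < 1\<close> they decay like \<open>norm z ^ n\<close>, and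
  \<open>(n + 1) * norm z ^ n\<close> is bounded.\<close>

lemma pgf_open_disc:
  fixes z :: complex
  assumes t: "0 \<le> t" and z: "norm z < 1"
  shows "(LINT \<omega>|M. z ^ counting X t \<omega>) = exp (immigration_exponent \<alpha> \<beta> \<gamma> t z t)"
proof -
  define G where "G = yule_pgf \<alpha> t z"
  define J where "J = immigration_exponent \<alpha> \<beta> \<gamma> t z"
  \<comment> \<open>\<open>h s (N\<^sub>s)\<close> is the martingale \<open>E (z ^ N\<^sub>t | F\<^sub>s)\<close>.\<close>
  define h where "h s n = G s ^ n * exp (J t - J s)" for s n
  have jump: "h s (Suc n) - h s n = h s n * (G s - 1)" for s n
    by (simp add: h_def algebra_simps)
  have deriv: "((\<lambda>s. h s n) has_vector_derivative
      - (of_real (\<beta> + \<alpha> * ((real n + \<gamma>) / (s + 1))) * (h s (Suc n) - h s n))) (at s within {0..t})"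
    if s: "0 \<le> s" "s \<le> t" for s n
  proof -
    define a where "a = complex_of_real (\<alpha> / (s + 1))"
    define r where "r = complex_of_real (\<beta> + \<alpha> * \<gamma> / (s + 1))"
    \<comment> \<open>The rate splits into immigration \<open>r\<close> and reproduction
      \<open>a\<close> per existing point. The exponential factor of \<open>h\<close> balances the
      first, the factor \<open>G s ^ n\<close> the second.\<close>
    have rate: "complex_of_real (\<beta> + \<alpha> * ((real n + \<gamma>) / (s + 1))) = r + a * of_nat n"
      by (simp add: a_def r_def add_divide_distrib algebra_simps)
    have G: "(G has_vector_derivative - (a * G s * (G s - 1))) (at s within {0..t})"
      unfolding G_def a_def using s z \<alpha> by (intro has_vector_derivative_yule_pgf) auto
    have J: "(J has_vector_derivative r * (G s - 1)) (at s within {0..t})"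
      unfolding J_def G_def r_def using s z \<alpha> by (intro immigration_exponent_vector_derivative) auto
    have "((\<lambda>x. x ^ n) has_field_derivative of_nat n * G s ^ (n - 1)) (at (G s) within A)" for A
      by (auto intro!: derivative_eq_intros)
    from field_vector_diff_chain_within[OF G this]
    have Gn: "((\<lambda>s. G s ^ n) has_vector_derivative
        - (a * G s * (G s - 1)) * (of_nat n * G s ^ (n - 1))) (at s within {0..t})"
      by (simp add: o_def)
    have "((\<lambda>x. exp (J t - x)) has_field_derivative - exp (J t - J s)) (at (J s) within A)" for A
      by (auto intro!: derivative_eq_intros)
    from field_vector_diff_chain_within[OF J this]
    have E: "((\<lambda>s. exp (J t - J s)) has_vector_derivative
        - (r * (G s - 1) * exp (J t - J s))) (at s within {0..t})"
      by (simp add: o_def)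
    \<comment> \<open>For \<open>n = 0\<close> the truncated exponent \<open>n - 1\<close> is
      harmless, since both sides carry the factor 0.\<close>
    have pow: "of_nat n * G s ^ (n - 1) * G s = of_nat n * G s ^ n" by (cases n) auto
    have "((\<lambda>s. h s n) has_vector_derivative
        G s ^ n * - (r * (G s - 1) * exp (J t - J s)) +
        - (a * G s * (G s - 1)) * (of_nat n * G s ^ (n - 1)) * exp (J t - J s)) (at s within {0..t})"
      unfolding h_def by (rule has_vector_derivative_mult[OF Gn E])
    also have "G s ^ n * - (r * (G s - 1) * exp (J t - J s)) +
        - (a * G s * (G s - 1)) * (of_nat n * G s ^ (n - 1)) * exp (J t - J s)
      = - (r * (G s - 1) * h s n) - a * (G s - 1) * (of_nat n * G s ^ (n - 1) * G s) * exp (J t - J s)"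
      by (simp add: h_def algebra_simps)
    also have "\<dots> = - (of_real (\<beta> + \<alpha> * ((real n + \<gamma>) / (s + 1))) * (h s (Suc n) - h s n))"
      unfolding pow jump rate by (simp add: h_def algebra_simps)
    finally show ?thesis .
  qed
  obtain E where E: "norm (exp (J t - J s)) \<le> E" if "s \<in> {0..t}" for s
  proof -
    have "continuous_on {0..t} J"
      unfolding J_def
    proof (rule continuous_on_vector_derivative)
      show "(immigration_exponent \<alpha> \<beta> \<gamma> t z has_vector_derivative
          of_real (\<beta> + \<alpha> * \<gamma> / (s + 1)) * (yule_pgf \<alpha> t z s - 1)) (at s within {0..t})"
        if "s \<in> {0..t}" for s
        using that z \<alpha> by (intro immigration_exponent_vector_derivative) auto
    qed
    then have "compact ((\<lambda>s. exp (J t - J s)) ` {0..t})"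
      by (intro compact_continuous_image continuous_intros) auto
    then obtain E where "\<forall>x\<in>(\<lambda>s. exp (J t - J s)) ` {0..t}. norm x \<le> E"
      using compact_imp_bounded bounded_iff by metis
    then show ?thesis by (intro that[of E]) auto
  qed
  obtain C where C: "(real n + 1) * norm z ^ n \<le> C" for n
  proof -
    have "(\<lambda>n. real n * norm z ^ n + norm z ^ n) \<longlonglongrightarrow> 0 + 0"
      using z by (intro tendsto_add powser_times_n_limit_0 LIMSEQ_power_zero) auto
    then have "Bseq (\<lambda>n. (real n + 1) * norm z ^ n)"
      by (intro convergent_imp_Bseq convergentI[of _ "0 + 0"]) (simp add: algebra_simps)
    then obtain C where "norm ((real n + 1) * norm z ^ n) \<le> C" for n
      unfolding Bseq_def by auto
    then show ?thesis using that by (metis abs_ge_self order.trans real_norm_def)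
  qed
  have bound: "(real n + 1) * norm (h s (Suc n) - h s n) \<le> C * (E * 2)" if s: "0 \<le> s" "s \<le> t" for s n
  proof -
    have G: "norm (G s) \<le> norm z"
      unfolding G_def using s z \<alpha> by (intro norm_yule_pgf_le) auto
    have G1: "norm (G s - 1) \<le> 2" using norm_triangle_ineq4[of "G s" 1] G z by simp
    have "(real n + 1) * norm (h s (Suc n) - h s n) =
        ((real n + 1) * norm (G s) ^ n) * (norm (exp (J t - J s)) * norm (G s - 1))"
      unfolding jump by (simp add: h_def norm_mult norm_power mult_ac)
    also have "\<dots> \<le> ((real n + 1) * norm z ^ n) * (norm (exp (J t - J s)) * norm (G s - 1))"
      using G by (intro mult_right_mono mult_left_mono power_mono) auto
    also have "\<dots> \<le> C * (norm (exp (J t - J s)) * norm (G s - 1))"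
      by (intro mult_right_mono C) auto
    also have "\<dots> \<le> C * (E * 2)"
    proof -
      have "0 \<le> C" using C[of 0] by simp
      moreover have "0 \<le> E" using E[of t] t by (auto intro: order.trans[OF norm_ge_zero])
      ultimately show ?thesis using E[of s] s G1 by (intro mult_left_mono mult_mono) auto
    qed
    finally show ?thesis .
  qed
  have h_end: "h t n = z ^ n" for n
    using t by (simp add: h_def G_def yule_pgf_def geom_param_def)
  have h_start: "h 0 0 = exp (J t)"
    by (simp add: h_def J_def immigration_exponent_def)
  \<comment> \<open>\<open>dynkin\<close> concerns real functions; as the rate is real, the equation
    for \<open>h\<close> passes to real and imaginary parts separately.\<close>
  have "expectation (\<lambda>\<omega>. Re (h t (counting X t \<omega>))) = Re (h 0 0)"
  proof (rule dynkin(2)[OF t, where K="C * (E * 2)" and h="\<lambda>s n. Re (h s n)"])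
    show "((\<lambda>s. Re (h s n)) has_real_derivative
        - ((\<beta> + \<alpha> * ((real n + \<gamma>) / (s + 1))) * (Re (h s (Suc n)) - Re (h s n)))) (at s within {0..t})"
      if "0 \<le> s" "s \<le> t" for s n
      using bounded_linear.has_vector_derivative[OF bounded_linear_Re deriv[OF that, of n]]
      by (simp add: has_real_derivative_iff_has_vector_derivative flip: of_real_add of_real_mult of_real_divide)
    show "(real n + 1) * \<bar>Re (h s (Suc n)) - Re (h s n)\<bar> \<le> C * (E * 2)" if "0 \<le> s" "s \<le> t" for s n
      by (rule order.trans[OF mult_left_mono bound[OF that, of n]])
        (use abs_Re_le_cmod[of "h s (Suc n) - h s n"] in auto)
  qed
  moreover have "expectation (\<lambda>\<omega>. Im (h t (counting X t \<omega>))) = Im (h 0 0)"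
  proof (rule dynkin(2)[OF t, where K="C * (E * 2)" and h="\<lambda>s n. Im (h s n)"])
    show "((\<lambda>s. Im (h s n)) has_real_derivative
        - ((\<beta> + \<alpha> * ((real n + \<gamma>) / (s + 1))) * (Im (h s (Suc n)) - Im (h s n)))) (at s within {0..t})"
      if "0 \<le> s" "s \<le> t" for s n
      using bounded_linear.has_vector_derivative[OF bounded_linear_Im deriv[OF that, of n]]
      by (simp add: has_real_derivative_iff_has_vector_derivative flip: of_real_add of_real_mult of_real_divide)
    show "(real n + 1) * \<bar>Im (h s (Suc n)) - Im (h s n)\<bar> \<le> C * (E * 2)" if "0 \<le> s" "s \<le> t" for s n
      by (rule order.trans[OF mult_left_mono bound[OF that, of n]])
        (use abs_Im_le_cmod[of "h s (Suc n) - h s n"] in auto)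
  qed
  moreover have "integrable M (\<lambda>\<omega>. z ^ counting X t \<omega>)"
    using z by (intro integrable_power_counting) auto
  ultimately show ?thesis
    by (intro complex_eqI) (simp_all add: h_end h_start J_def flip: integral_Re integral_Im)
qed

text \<open>The point \<open>z\<close> is approached radially from inside the disc. The expectations
  converge by dominated convergence with bound 1, the exponents by continuity on the closed
  disc.\<close>

lemma pgf_closed_disc:
  fixes z :: complex
  assumes t: "0 \<le> t" and z: "norm z \<le> 1"
  shows "(LINT \<omega>|M. z ^ counting X t \<omega>) = exp (immigration_exponent \<alpha> \<beta> \<gamma> t z t)"
proof (rule LIMSEQ_unique)
  define c where "c k = 1 - inverse (real (Suc k))" for k
  have c: "0 \<le> c k" "c k < 1" for k by (auto simp: c_def field_simps)
  have "c \<longlonglongrightarrow> 1 - 0"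
    unfolding c_def by (intro tendsto_diff tendsto_const LIMSEQ_inverse_real_of_nat)
  then have lim: "(\<lambda>k. of_real (c k) * z) \<longlonglongrightarrow> z"
    using tendsto_mult[OF tendsto_of_real tendsto_const] by fastforce
  have norm: "norm (of_real (c k) * z) < 1" for k
    using c[of k] z by (simp add: norm_mult) (metis mult_left_le order_le_less_trans)
  show "(\<lambda>k. LINT \<omega>|M. (of_real (c k) * z) ^ counting X t \<omega>) \<longlonglongrightarrow> (LINT \<omega>|M. z ^ counting X t \<omega>)"
  proof (rule integral_dominated_convergence[where w="\<lambda>_. 1"])
    show "AE \<omega> in M. norm ((of_real (c k) * z) ^ counting X t \<omega>) \<le> 1" for k
      using norm[of k] by (auto simp: norm_power intro!: power_le_one)
  qed (auto intro!: tendsto_power lim)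
  have "(\<lambda>k. exp (immigration_exponent \<alpha> \<beta> \<gamma> t (of_real (c k) * z) t)) \<longlonglongrightarrow>
      exp (immigration_exponent \<alpha> \<beta> \<gamma> t z t)"
    by (intro tendsto_exp continuous_on_tendsto_compose[OF continuous_on_immigration_exponent[OF \<alpha>] lim])
      (use norm z in \<open>auto intro!: always_eventually less_imp_le\<close>)
  then show "(\<lambda>k. LINT \<omega>|M. (of_real (c k) * z) ^ counting X t \<omega>) \<longlonglongrightarrow>
      exp (immigration_exponent \<alpha> \<beta> \<gamma> t z t)"
    using pgf_open_disc[OF t norm] by simp
qed

end

section \<open>Gaussian limit\<close>

lemma has_integral_powr_shift:
  fixes b t :: real
  assumes "0 \<le> t" "b \<noteq> -1"
  shows "((\<lambda>s. (s + 1) powr b) has_integral (((t + 1) powr (b + 1) - 1) / (b + 1))) {0..t}"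
proof -
  have "((\<lambda>s. (s + 1) powr (b + 1) / (b + 1)) has_real_derivative (s + 1) powr b) (at s within {0..t})"
    if "s \<in> {0..t}" for s
    using that assms by (auto intro!: derivative_eq_intros simp: add_eq_0_iff)
  then have "((\<lambda>s. (s + 1) powr b) has_integral
      ((t + 1) powr (b + 1) / (b + 1) - (0 + 1) powr (b + 1) / (b + 1))) {0..t}"
    using assms by (intro fundamental_theorem_of_calculus)
      (auto simp flip: has_real_derivative_iff_has_vector_derivative)
  then show ?thesis by (simp add: diff_divide_distrib)
qed

text \<open>In terms of \<open>y\<close> the generating function is \<open>1 / (1 + y)\<close>. The
  dependence on \<open>z\<close> and on \<open>s\<close> separates into a product in
  \<open>y\<close>, so the powers of \<open>y\<close> have explicit time integrals.\<close>

lemma yule_pgf_minus_one: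
  fixes z :: complex
  assumes "0 < \<alpha>" "0 \<le> s" "s \<le> t" "norm z = 1"
  defines "y \<equiv> (1 / z - 1) * of_real ((t + 1) powr \<alpha> * (s + 1) powr (- \<alpha>))"
  shows "yule_pgf \<alpha> t z s - 1 = - y / (1 + y)"
proof -
  define p where "p = complex_of_real (geom_param \<alpha> t s)"
  have p: "p \<noteq> 0" using geom_param_bounds[OF assms(2,3,1)] by (simp add: p_def)
  have z: "z \<noteq> 0" using assms by auto
  have "(t + 1) powr \<alpha> * (s + 1) powr (- \<alpha>) = inverse (geom_param \<alpha> t s)"
    using assms by (simp add: geom_param_def powr_divide powr_minus field_simps)
  then have y: "y = (1 - z) / (z * p)"
    using z p by (simp only: y_def of_real_inverse flip: p_def) (simp add: field_simps)
  have d: "1 - (1 - p) * z \<noteq> 0"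
    unfolding p_def using assms by (intro yule_pgf_denominator) auto
  have y1: "1 + y = (1 - (1 - p) * z) / (z * p)"
    using z p by (simp add: y field_simps)
  have "- y / (1 + y) = (z - 1) / (1 - (1 - p) * z)"
    unfolding y1 using z p d by (simp add: y minus_divide_left)
  also have "\<dots> = yule_pgf \<alpha> t z s - 1"
    using d by (simp add: yule_pgf_def field_simps flip: p_def)
  finally show ?thesis by simp
qed

text \<open>The geometric series is cut after its second term; the remainder is
  \<open>- y ^ 3 / (1 + y)\<close>, and the denominator has norm at least 1 / 2.\<close>

lemma geometric_remainder:
  fixes y :: complex
  assumes "norm y \<le> 1 / 2"
  shows "norm (- y / (1 + y)) \<le> 2 * norm y"
    and "norm (- y / (1 + y) - (- y + y\<^sup>2)) \<le> 2 * norm y ^ 3"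
proof -
  have d: "1 / 2 \<le> norm (1 + y)"
    using norm_triangle_ineq2[of 1 "- y"] assms by simp
  have inv: "norm x / norm (1 + y) \<le> 2 * norm x" for x :: complex
  proof -
    have "norm x * 1 \<le> norm x * (2 * norm (1 + y))" using d by (intro mult_left_mono) auto
    then show ?thesis using d by (simp add: divide_le_eq mult_ac)
  qed
  show "norm (- y / (1 + y)) \<le> 2 * norm y"
    using inv[of y] by (simp add: norm_divide)
  have "1 + y \<noteq> 0" using d by auto
  then have "- y / (1 + y) - (- y + y\<^sup>2) = - (y ^ 3) / (1 + y)"
    by (simp add: field_simps power2_eq_square power3_eq_cube)
  then show "norm (- y / (1 + y) - (- y + y\<^sup>2)) \<le> 2 * norm y ^ 3"
    using inv[of "y ^ 3"] by (simp add: norm_divide norm_power)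
qed

text \<open>With \<open>y = w * q\<close>, \<open>Q1\<close> and \<open>Q2\<close> are the integrals
  of \<open>q\<close> and of its square. The first error term is the cubic remainder for the
  immigration rate \<open>\<beta>\<close>; the second is the whole contribution of the initial
  condition \<open>\<gamma>\<close>.\<close>

lemma immigration_exponent_expansion:
  fixes z w :: complex and \<alpha> \<beta> \<gamma> t Q1 Q2 :: real
  assumes \<alpha>: "0 < \<alpha>" "\<alpha> < 1 / 2" and "0 \<le> \<beta>" "0 \<le> \<gamma>" and t: "0 \<le> t" and z: "norm z = 1"
    and w: "w = 1 / z - 1" "norm w * (t + 1) powr \<alpha> \<le> 1 / 2"
    and Q1: "Q1 = (t + 1 - (t + 1) powr \<alpha>) / (1 - \<alpha>)"
    and Q2: "Q2 = (t + 1 - (t + 1) powr (2 * \<alpha>)) / (1 - 2 * \<alpha>)"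
  shows "norm (immigration_exponent \<alpha> \<beta> \<gamma> t z t - \<beta> * (- w * Q1 + w\<^sup>2 * Q2))
    \<le> 2 * \<beta> * norm w ^ 3 * (t + 1) powr \<alpha> * Q2 + 2 * \<gamma> * norm w * (t + 1) powr \<alpha>"
proof -
  define T where "T = (t + 1) powr \<alpha>"
  define q where "q s = T * (s + 1) powr (- \<alpha>)" for s
  define y where "y s = w * complex_of_real (q s)" for s
  define F where "F s = complex_of_real (\<beta> + \<alpha> * \<gamma> / (s + 1)) * (yule_pgf \<alpha> t z s - 1)" for s
  define F0 where "F0 s = complex_of_real \<beta> * (- y s + (y s)\<^sup>2)" for s
  have T: "0 < T" using t by (simp add: T_def)
  have q2: "(q s)\<^sup>2 = T\<^sup>2 * (s + 1) powr (- 2 * \<alpha>)" for s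
    by (simp add: q_def power_mult_distrib power2_eq_square flip: powr_add)
  have q_int: "(q has_integral Q1) {0..t}"
  proof -
    have "(q has_integral T * (((t + 1) powr (- \<alpha> + 1) - 1) / (- \<alpha> + 1))) {0..t}"
      unfolding q_def using \<alpha> t by (intro has_integral_mult_right has_integral_powr_shift) auto
    moreover have "T * (t + 1) powr (- \<alpha> + 1) = t + 1"
      using t by (simp add: T_def flip: powr_add)
    ultimately show ?thesis by (simp add: Q1 T_def[symmetric] right_diff_distrib)
  qed
  have q2_int: "((\<lambda>s. (q s)\<^sup>2) has_integral Q2) {0..t}"
  proof -
    have "((\<lambda>s. (q s)\<^sup>2) has_integral T\<^sup>2 * (((t + 1) powr (- 2 * \<alpha> + 1) - 1) / (- 2 * \<alpha> + 1))) {0..t}"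
      unfolding q2 using \<alpha> t by (intro has_integral_mult_right has_integral_powr_shift) auto
    moreover have T2: "T\<^sup>2 = (t + 1) powr (2 * \<alpha>)"
      by (simp add: T_def power2_eq_square flip: powr_add)
    moreover have "T\<^sup>2 * (t + 1) powr (- 2 * \<alpha> + 1) = t + 1"
      unfolding T2 using t by (simp flip: powr_add)
    ultimately show ?thesis by (simp add: Q2 right_diff_distrib)
  qed
  have F0_int: "(F0 has_integral (\<beta> * (- w * Q1 + w\<^sup>2 * Q2))) {0..t}"
  proof -
    have 1: "((\<lambda>s. complex_of_real (q s)) has_integral Q1) {0..t}"
      using has_integral_linear[OF q_int bounded_linear_of_real] by (simp add: o_def)
    have 2: "((\<lambda>s. complex_of_real ((q s)\<^sup>2)) has_integral Q2) {0..t}"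
      using has_integral_linear[OF q2_int bounded_linear_of_real] by (simp add: o_def)
    have "F0 = (\<lambda>s. complex_of_real \<beta> * (- w * complex_of_real (q s) + w\<^sup>2 * complex_of_real ((q s)\<^sup>2)))"
      by (simp add: F0_def y_def power_mult_distrib fun_eq_iff)
    then show ?thesis
      by (simp only:) (intro has_integral_mult_right has_integral_add 1 2)
  qed
  have F_int: "F integrable_on {0..t}"
    unfolding F_def using \<alpha> z
    by (intro integrable_continuous_real continuous_intros continuous_on_yule_pgf') auto
  define g where "g s = 2 * \<beta> * norm w ^ 3 * T * (q s)\<^sup>2 + 2 * \<alpha> * \<gamma> * norm w * T * (s + 1) powr (- \<alpha> - 1)" for s
  define I where "I = 2 * \<beta> * norm w ^ 3 * T * Q2 +
    2 * \<alpha> * \<gamma> * norm w * T * (((t + 1) powr (- \<alpha> - 1 + 1) - 1) / (- \<alpha> - 1 + 1))"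
  have g_int: "(g has_integral I) {0..t}"
    unfolding g_def I_def using \<alpha> t
    by (intro has_integral_add has_integral_mult_right q2_int has_integral_powr_shift) auto
  have le: "norm (F s - F0 s) \<le> g s" if s: "s \<in> {0..t}" for s
  proof -
    have q: "0 < q s" "q s \<le> T"
      using s T \<alpha> by (auto simp: q_def powr_minus inverse_le_1_iff ge_one_powr_ge_zero intro!: mult_left_le)
    have ny: "norm (y s) = norm w * q s" using q by (simp add: y_def norm_mult)
    have "norm (y s) \<le> norm w * T" unfolding ny using q by (intro mult_left_mono) auto
    then have y: "norm (y s) \<le> 1 / 2" using w by (simp add: T_def)
    have G: "yule_pgf \<alpha> t z s - 1 = - y s / (1 + y s)"
      using yule_pgf_minus_one[OF \<alpha>(1), of s t z] s z by (simp add: y_def w q_def T_def)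
    have split: "F s - F0 s = of_real \<beta> * (- y s / (1 + y s) - (- y s + (y s)\<^sup>2))
        + of_real (\<alpha> * \<gamma> / (s + 1)) * (- y s / (1 + y s))"
      unfolding F_def F0_def G by (simp add: algebra_simps)
    have "norm (F s - F0 s) \<le> \<beta> * (2 * norm (y s) ^ 3) + \<alpha> * \<gamma> / (s + 1) * (2 * norm (y s))"
      unfolding split
    proof (rule order.trans[OF norm_triangle_ineq], rule add_mono)
      show "norm (of_real \<beta> * (- y s / (1 + y s) - (- y s + (y s)\<^sup>2))) \<le> \<beta> * (2 * norm (y s) ^ 3)"
        unfolding norm_mult norm_of_real using geometric_remainder(2)[OF y] \<open>0 \<le> \<beta>\<close>
        by (simp add: mult_left_mono)
      have nn: "0 \<le> \<alpha> * \<gamma> / (s + 1)" using \<alpha> \<open>0 \<le> \<gamma>\<close> s by simp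
      show "norm (of_real (\<alpha> * \<gamma> / (s + 1)) * (- y s / (1 + y s))) \<le> \<alpha> * \<gamma> / (s + 1) * (2 * norm (y s))"
        unfolding norm_mult norm_of_real abs_of_nonneg[OF nn]
        by (intro mult_left_mono geometric_remainder(1) y nn)
    qed
    also have "\<beta> * (2 * norm (y s) ^ 3) = 2 * \<beta> * norm w ^ 3 * (q s * (q s)\<^sup>2)"
      by (simp add: ny power_mult_distrib power2_eq_square power3_eq_cube)
    \<comment> \<open>Bounding one factor \<open>q s\<close> by \<open>T\<close> reduces the cubic
      term to the integral \<open>Q2\<close>. Integrating the cube directly would produce a
      logarithm at \<open>\<alpha> = 1 / 3\<close>.\<close>
    also have "\<dots> \<le> 2 * \<beta> * norm w ^ 3 * (T * (q s)\<^sup>2)"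
      using q \<open>0 \<le> \<beta>\<close> by (intro mult_left_mono mult_right_mono) auto
    also have "\<alpha> * \<gamma> / (s + 1) * (2 * norm (y s)) = 2 * \<alpha> * \<gamma> * norm w * T * (s + 1) powr (- \<alpha> - 1)"
      using s by (simp add: ny q_def powr_diff)
    finally show ?thesis by (simp add: g_def mult_ac)
  qed
  have "immigration_exponent \<alpha> \<beta> \<gamma> t z t - \<beta> * (- w * Q1 + w\<^sup>2 * Q2) = integral {0..t} (\<lambda>s. F s - F0 s)"
    using F_int F0_int by (simp add: immigration_exponent_def F_def[abs_def] Henstock_Kurzweil_Integration.integral_diff
        has_integral_iff)
  also have "norm \<dots> \<le> integral {0..t} g"
    using F_int F0_int g_int le
    by (intro integral_norm_bound_integral integrable_diff) (auto simp: has_integral_iff)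
  also have "\<dots> = I" using g_int by (rule integral_unique)
  \<comment> \<open>The integral of \<open>(s + 1) powr (- \<alpha> - 1)\<close> is at most
    \<open>1 / \<alpha>\<close> for every \<open>t\<close>, which cancels the factor
    \<open>\<alpha>\<close> of the error.\<close>
  also have "I \<le> 2 * \<beta> * norm w ^ 3 * T * Q2 + 2 * \<alpha> * \<gamma> * norm w * T * (1 / \<alpha>)"
    unfolding I_def using \<alpha> \<open>0 \<le> \<gamma>\<close> T
    by (intro add_left_mono mult_left_mono) (auto simp: field_simps)
  finally show ?thesis using \<alpha> by (simp add: T_def)
qed

section \<open>Limit of the exponent as time tends to infinity\<close>

lemma tendsto_sqrt_iexp_minus_1:
  "((\<lambda>t. of_real (sqrt t) * (exp (- (\<i> * of_real (u / sqrt t))) - 1)) \<longlongrightarrow> - (\<i> * of_real u)) at_top"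
proof -
  have "((\<lambda>t. sqrt t * (cos (u / sqrt t) - 1)) \<longlongrightarrow> 0) at_top"
  \<comment> \<open>The expansion at infinity is computed for each sign of \<open>u\<close>; at
    \<open>u = 0\<close> the expression is constantly 0.\<close>
  proof (cases u "0::real" rule: linorder_cases)
    case less
    then show ?thesis by real_asymp
  next
    case greater
    then show ?thesis by real_asymp
  qed simp
  moreover have "((\<lambda>t. - (sqrt t * sin (u / sqrt t))) \<longlongrightarrow> - u) at_top"
  proof (cases u "0::real" rule: linorder_cases)
    case less
    then show ?thesis by real_asymp
  next
    case greater
    then show ?thesis by real_asymp
  qed simp
  ultimately have "((\<lambda>t. Complex (sqrt t * (cos (u / sqrt t) - 1)) (- (sqrt t * sin (u / sqrt t))))
      \<longlongrightarrow> Complex 0 (- u)) at_top"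
    by (rule tendsto_Complex)
  moreover have "Complex (sqrt t * (cos (u / sqrt t) - 1)) (- (sqrt t * sin (u / sqrt t))) =
      of_real (sqrt t) * (exp (- (\<i> * of_real (u / sqrt t))) - 1)" for t
    by (simp add: complex_eq_iff Re_exp Im_exp)
  moreover have "Complex 0 (- u) = - (\<i> * of_real u)" by (simp add: complex_eq_iff)
  ultimately show ?thesis by simp
qed

text \<open>The centering removes the imaginary part of order \<open>sqrt t\<close>, and
  \<open>1 - cos (u / sqrt t)\<close> times \<open>t\<close> leaves half of the square of
  \<open>u\<close>. The correction \<open>(t + 1) powr \<alpha>\<close> contributes to the imaginary
  part at order \<open>t powr (\<alpha> - 1 / 2)\<close>, which vanishes because
  \<open>\<alpha> < 1 / 2\<close>.\<close>

lemma tendsto_first_order_term: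
  assumes \<alpha>: "0 < \<alpha>" "\<alpha> < 1 / 2"
  shows "((\<lambda>t. - (exp (- (\<i> * of_real (u / sqrt t))) - 1) * of_real ((t + 1 - (t + 1) powr \<alpha>) / (1 - \<alpha>))
     - \<i> * of_real (u * sqrt t / (1 - \<alpha>))) \<longlongrightarrow> of_real (u\<^sup>2 / (2 * (1 - \<alpha>)))) at_top"
proof -
  have re: "((\<lambda>t. (1 - cos (u / sqrt t)) * (t + 1 - (t + 1) powr \<alpha>) / (1 - \<alpha>))
      \<longlongrightarrow> (u * u / 2) / (1 - \<alpha>)) at_top"
  proof (rule tendsto_divide)
    show "((\<lambda>t. (1 - cos (u / sqrt t)) * (t + 1 - (t + 1) powr \<alpha>)) \<longlongrightarrow> u * u / 2) at_top"
    proof (cases u "0::real" rule: linorder_cases)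
 case less
 then show ?thesis using assms by real_asymp
 next
 case greater
 then show ?thesis using assms by real_asymp
 qed simp
  qed (use \<alpha> in auto)
  have im: "((\<lambda>t. (sin (u / sqrt t) * (t + 1 - (t + 1) powr \<alpha>) - u * sqrt t) / (1 - \<alpha>))
      \<longlongrightarrow> 0 / (1 - \<alpha>)) at_top"
  proof (rule tendsto_divide)
    show "((\<lambda>t. sin (u / sqrt t) * (t + 1 - (t + 1) powr \<alpha>) - u * sqrt t) \<longlongrightarrow> 0) at_top"
    proof (cases u "0::real" rule: linorder_cases)
 case less
 then show ?thesis using assms by real_asymp
 next
 case greater
 then show ?thesis using assms by real_asymp
 qed simp
  qed (use \<alpha> in auto)
  have "Complex ((1 - cos (u / sqrt t)) * (t + 1 - (t + 1) powr \<alpha>) / (1 - \<alpha>))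
      ((sin (u / sqrt t) * (t + 1 - (t + 1) powr \<alpha>) - u * sqrt t) / (1 - \<alpha>)) =
      - (exp (- (\<i> * of_real (u / sqrt t))) - 1) * of_real ((t + 1 - (t + 1) powr \<alpha>) / (1 - \<alpha>))
     - \<i> * of_real (u * sqrt t / (1 - \<alpha>))" for t
    by (simp add: complex_eq_iff Re_exp Im_exp diff_divide_distrib[of _ "u * sqrt t"])
  moreover have "Complex ((u * u / 2) / (1 - \<alpha>)) (0 / (1 - \<alpha>)) = of_real (u\<^sup>2 / (2 * (1 - \<alpha>)))"
    by (simp add: complex_eq_iff power2_eq_square)
  ultimately show ?thesis using tendsto_Complex[OF re im] by simp
qed

lemma tendsto_immigration_exponent:
  assumes \<alpha>: "0 < \<alpha>" "\<alpha> < 1 / 2" and "0 \<le> \<beta>" "0 \<le> \<gamma>"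
  shows "((\<lambda>t. immigration_exponent \<alpha> \<beta> \<gamma> t (exp (\<i> * of_real (u / sqrt t))) t
      - \<i> * of_real (u * (\<beta> / (1 - \<alpha>)) * sqrt t))
    \<longlongrightarrow> of_real (- (\<beta> / ((1 - 2 * \<alpha>) * (1 - \<alpha>)) * u\<^sup>2 / 2))) at_top"
proof -
  define w where "w t = exp (- (\<i> * of_real (u / sqrt t))) - 1" for t
  define Q1 where "Q1 t = (t + 1 - (t + 1) powr \<alpha>) / (1 - \<alpha>)" for t
  define Q2 where "Q2 t = (t + 1 - (t + 1) powr (2 * \<alpha>)) / (1 - 2 * \<alpha>)" for t
  define J where "J t = immigration_exponent \<alpha> \<beta> \<gamma> t (exp (\<i> * of_real (u / sqrt t))) t" for t
  define main where "main t = of_real \<beta> * (- w t * of_real (Q1 t) + (w t)\<^sup>2 * of_real (Q2 t))" for t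
  define err where "err t = 2 * \<beta> * norm (w t) ^ 3 * (t + 1) powr \<alpha> * Q2 t + 2 * \<gamma> * norm (w t) * (t + 1) powr \<alpha>" for t
  have w: "((\<lambda>t. of_real (sqrt t) * w t) \<longlongrightarrow> - (\<i> * of_real u)) at_top"
    unfolding w_def by (rule tendsto_sqrt_iexp_minus_1)
  have nw: "((\<lambda>t. sqrt t * norm (w t)) \<longlongrightarrow> \<bar>u\<bar>) at_top"
  proof (rule Lim_transform_eventually)
    show "((\<lambda>t. norm (of_real (sqrt t) * w t)) \<longlongrightarrow> \<bar>u\<bar>) at_top"
      using tendsto_norm[OF w] by (simp only: norm_minus_cancel norm_mult norm_ii norm_of_real mult_1)
    show "\<forall>\<^sub>F t in at_top. norm (of_real (sqrt t) * w t) = sqrt t * norm (w t)"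
      using eventually_ge_at_top[of 0] by eventually_elim (simp add: norm_mult)
  qed
  have "((\<lambda>t. (t + 1 - (t + 1) powr (2 * \<alpha>)) / t) \<longlongrightarrow> 1) at_top"
    using \<alpha> by real_asymp
  from tendsto_divide[OF this tendsto_const[of "1 - 2 * \<alpha>"]]
  have Q2: "((\<lambda>t. Q2 t / t) \<longlongrightarrow> 1 / (1 - 2 * \<alpha>)) at_top"
    using \<alpha> by (simp add: Q2_def mult.commute)
  have "((\<lambda>t. (t + 1) powr \<alpha> / sqrt t) \<longlongrightarrow> 0) at_top"
    using \<alpha> by real_asymp
  from tendsto_mult[OF nw this]
  have "((\<lambda>t. sqrt t * norm (w t) * ((t + 1) powr \<alpha> / sqrt t)) \<longlongrightarrow> 0) at_top" by simp
  \<comment> \<open>This limit makes the smallness condition of the expansion hold eventually and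
    also drives both error terms to 0.\<close>
  then have wT: "((\<lambda>t. norm (w t) * (t + 1) powr \<alpha>) \<longlongrightarrow> 0) at_top"
  proof (rule Lim_transform_eventually)
    show "\<forall>\<^sub>F t in at_top. sqrt t * norm (w t) * ((t + 1) powr \<alpha> / sqrt t) = norm (w t) * (t + 1) powr \<alpha>"
      using eventually_gt_at_top[of 0] by eventually_elim simp
  qed
  have err: "(err \<longlongrightarrow> 0) at_top"
  proof -
    \<comment> \<open>The cubic error is regrouped into factors with finite limits: one power of
      \<open>w\<close> goes with \<open>(t + 1) powr \<alpha>\<close> and tends to 0, two go with
      \<open>sqrt t\<close>, and \<open>Q2\<close> is divided by \<open>t\<close>.\<close>
    have "((\<lambda>t. 2 * \<beta> * (norm (w t) * (t + 1) powr \<alpha>) * (sqrt t * norm (w t))\<^sup>2 * (Q2 t / t)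
        + 2 * \<gamma> * (norm (w t) * (t + 1) powr \<alpha>))
        \<longlongrightarrow> 2 * \<beta> * 0 * \<bar>u\<bar>\<^sup>2 * (1 / (1 - 2 * \<alpha>)) + 2 * \<gamma> * 0) at_top"
      by (intro tendsto_intros wT nw Q2)
    then have "((\<lambda>t. 2 * \<beta> * (norm (w t) * (t + 1) powr \<alpha>) * (sqrt t * norm (w t))\<^sup>2 * (Q2 t / t)
        + 2 * \<gamma> * (norm (w t) * (t + 1) powr \<alpha>)) \<longlongrightarrow> 0) at_top"
      by simp
    then show ?thesis
    proof (rule Lim_transform_eventually)
      show "\<forall>\<^sub>F t in at_top. 2 * \<beta> * (norm (w t) * (t + 1) powr \<alpha>) * (sqrt t * norm (w t))\<^sup>2 * (Q2 t / t)
        + 2 * \<gamma> * (norm (w t) * (t + 1) powr \<alpha>) = err t"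
        using eventually_gt_at_top[of 0]
        by eventually_elim (simp add: err_def power_mult_distrib, simp add: power2_eq_square power3_eq_cube)
    qed
  qed
  have main: "((\<lambda>t. main t - \<i> * of_real (u * (\<beta> / (1 - \<alpha>)) * sqrt t))
      \<longlongrightarrow> of_real (- (\<beta> / ((1 - 2 * \<alpha>) * (1 - \<alpha>)) * u\<^sup>2 / 2))) at_top"
  proof -
    have first: "((\<lambda>t. - w t * of_real (Q1 t) - \<i> * of_real (u * sqrt t / (1 - \<alpha>)))
        \<longlongrightarrow> of_real (u\<^sup>2 / (2 * (1 - \<alpha>)))) at_top"
      unfolding w_def Q1_def by (rule tendsto_first_order_term[OF \<alpha>])
    have "((\<lambda>t. of_real \<beta> * ((- w t * of_real (Q1 t) - \<i> * of_real (u * sqrt t / (1 - \<alpha>)))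
          + (of_real (sqrt t) * w t)\<^sup>2 * of_real (Q2 t / t)))
        \<longlongrightarrow> of_real \<beta> * (of_real (u\<^sup>2 / (2 * (1 - \<alpha>))) + (- (\<i> * of_real u))\<^sup>2 * of_real (1 / (1 - 2 * \<alpha>)))) at_top"
      by (intro tendsto_mult[OF tendsto_const] tendsto_add tendsto_mult[OF tendsto_power[OF w] tendsto_of_real[OF Q2]]
          first)
    also have "of_real \<beta> * (of_real (u\<^sup>2 / (2 * (1 - \<alpha>))) + (- (\<i> * of_real u))\<^sup>2 * of_real (1 / (1 - 2 * \<alpha>)))
        = complex_of_real (\<beta> * (u\<^sup>2 / (2 * (1 - \<alpha>)) - u\<^sup>2 / (1 - 2 * \<alpha>)))"
      by (simp add: power_mult_distrib)
    \<comment> \<open>Over the common denominator the numerator is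
      \<open>(1 - 2 * \<alpha>) - 2 * (1 - \<alpha>) = - 1\<close>: the positive first-order term is
      outweighed by the second-order one, and the stated variance results.\<close>
    also have "\<beta> * (u\<^sup>2 / (2 * (1 - \<alpha>)) - u\<^sup>2 / (1 - 2 * \<alpha>)) = - (\<beta> / ((1 - 2 * \<alpha>) * (1 - \<alpha>)) * u\<^sup>2 / 2)"
    proof -
      have "1 - \<alpha> \<noteq> 0" "1 - 2 * \<alpha> \<noteq> 0" using \<alpha> by auto
      then show ?thesis by (simp add: divide_simps) (simp add: algebra_simps)
    qed
    finally show ?thesis
    proof (rule Lim_transform_eventually, intro eventually_mono[OF eventually_gt_at_top[of 0]])
      fix t :: real assume t: "0 < t"
      then have "(complex_of_real (sqrt t) * w t)\<^sup>2 = of_real t * (w t)\<^sup>2"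
        by (simp add: power_mult_distrib flip: of_real_power)
      then have "(of_real (sqrt t) * w t)\<^sup>2 * of_real (Q2 t / t) = (w t)\<^sup>2 * of_real (Q2 t)"
        using t by simp
      then show "of_real \<beta> * ((- w t * of_real (Q1 t) - \<i> * of_real (u * sqrt t / (1 - \<alpha>)))
          + (of_real (sqrt t) * w t)\<^sup>2 * of_real (Q2 t / t)) =
          main t - \<i> * of_real (u * (\<beta> / (1 - \<alpha>)) * sqrt t)"
        by (simp add: main_def algebra_simps)
    qed
  qed
  have "eventually (\<lambda>t. norm (w t) * (t + 1) powr \<alpha> < 1 / 2) at_top"
    by (rule order_tendstoD(2)[OF wT]) simp
  then have "eventually (\<lambda>t. norm (J t - main t) \<le> err t) at_top"
    using eventually_ge_at_top[of 0]
  proof eventually_elim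
    case (elim t)
    show ?case
      unfolding J_def main_def err_def
      by (rule immigration_exponent_expansion[OF assms elim(2)])
        (use elim in \<open>simp_all add: w_def exp_minus field_simps Q1_def Q2_def flip: of_real_divide\<close>)
  qed
  then have "((\<lambda>t. J t - main t) \<longlongrightarrow> 0) at_top"
    by (rule Lim_null_comparison[OF _ err])
  from tendsto_add[OF this main] show ?thesis by (simp add: J_def)
qed

section \<open>Characteristic functions and convergence in distribution\<close>

lemma char_normal_distribution:
  assumes "0 < \<sigma>"
  shows "char (density lborel (normal_density 0 \<sigma>)) u = of_real (exp (- (\<sigma>\<^sup>2 * u\<^sup>2) / 2))"
proof -
  interpret N: prob_space std_normal_distribution by (rule prob_space_normal_density) simp
  have "distributed std_normal_distribution lborel (\<lambda>x. x) std_normal_density"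
    by (auto simp: distributed_def distr_id2)
  from N.normal_density_affine[OF this, of \<sigma> 0] assms
  have "distributed std_normal_distribution lborel (\<lambda>x. \<sigma> * x) (normal_density 0 \<sigma>)" by simp
  then have "density lborel (normal_density 0 \<sigma>) = distr std_normal_distribution lborel (\<lambda>x. \<sigma> * x)"
    by (simp add: distributed_def)
  then have "char (density lborel (normal_density 0 \<sigma>)) u = char std_normal_distribution (\<sigma> * u)"
    by (simp add: char_def integral_distr mult_ac)
  then show ?thesis by (simp add: char_std_normal_distribution power_mult_distrib)
qed

context linear_rate_process
begin

text \<open>The deterministic centering factors out of the expectation and leaves the generating
  function at \<open>exp (\<i> * of_real (u / sqrt t))\<close>, a point of the unit circle.\<close>

lemma char_scaled_counting:
  assumes "0 < t"
  shows "char (distr M borel (\<lambda>\<omega>. (real (counting X t \<omega>) - c * t) / sqrt t)) u =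
    exp (immigration_exponent \<alpha> \<beta> \<gamma> t (exp (\<i> * of_real (u / sqrt t))) t - \<i> * of_real (u * c * sqrt t))"
proof -
  let ?z = "exp (\<i> * of_real (u / sqrt t))"
  have "iexp (u * ((real n - c * t) / sqrt t)) = exp (- (\<i> * of_real (u * c * sqrt t))) * ?z ^ n" for n
  proof -
    have "u * ((real n - c * t) / sqrt t) = real n * (u / sqrt t) - u * c * (t / sqrt t)"
      by (simp add: diff_divide_distrib algebra_simps)
    also have "t / sqrt t = sqrt t" using assms by (simp add: real_div_sqrt)
    finally have eq: "u * ((real n - c * t) / sqrt t) = real n * (u / sqrt t) - u * c * sqrt t" .
    have "iexp (u * ((real n - c * t) / sqrt t)) =
        exp (- (\<i> * of_real (u * c * sqrt t)) + of_nat n * (\<i> * of_real (u / sqrt t)))"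
      unfolding eq by (simp add: algebra_simps)
    then show ?thesis by (simp only: exp_add exp_of_nat_mult)
  qed
  then have "char (distr M borel (\<lambda>\<omega>. (real (counting X t \<omega>) - c * t) / sqrt t)) u =
      exp (- (\<i> * of_real (u * c * sqrt t))) * (LINT \<omega>|M. ?z ^ counting X t \<omega>)"
    by (simp add: char_def integral_distr)
  also have "(LINT \<omega>|M. ?z ^ counting X t \<omega>) = exp (immigration_exponent \<alpha> \<beta> \<gamma> t ?z t)"
    using assms by (intro pgf_closed_disc) auto
  finally show ?thesis by (simp add: exp_diff exp_minus divide_inverse mult.commute)
qed

end

theorem theorem15:
  fixes M :: "'a measure" and X :: "'a \<Rightarrow> real set" and \<alpha> \<beta> \<gamma> :: real
  assumes "prob_space M"
    and "0 < \<alpha>" and "\<alpha> < 1 / 2" and "0 < \<beta>" and "0 \<le> \<gamma>"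
    and "self_exciting_process M (\<lambda>z. \<beta> + \<alpha> * z) \<gamma> X"
  shows "weak_conv_along
      (\<lambda>t. distr M borel (\<lambda>\<omega>. (real (counting X t \<omega>) - \<beta> / (1 - \<alpha>) * t) / sqrt t))
      (density lborel (normal_density 0 (sqrt (\<beta> / ((1 - 2 * \<alpha>) * (1 - \<alpha>))))))
      at_top"
proof -
  interpret prob_space M by fact
  interpret linear_rate_process M X \<alpha> \<beta> \<gamma> by unfold_locales (use assms in auto)
  define v where "v = \<beta> / ((1 - 2 * \<alpha>) * (1 - \<alpha>))"
  have v: "0 < v" using assms by (simp add: v_def)
  let ?D = "\<lambda>t. distr M borel (\<lambda>\<omega>. (real (counting X t \<omega>) - \<beta> / (1 - \<alpha>) * t) / sqrt t)"
  let ?N = "density lborel (normal_density 0 (sqrt v))"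
  have D: "real_distribution (?D t)" for t
    by (rule real_distribution_distr) measurable
  have N: "real_distribution ?N"
    using v by (intro real_distribution.intro prob_space_normal_density) (auto simp: real_distribution_axioms_def)
  have char: "((\<lambda>t. char (?D t) u) \<longlongrightarrow> char ?N u) at_top" for u
  proof -
    have "((\<lambda>t. exp (immigration_exponent \<alpha> \<beta> \<gamma> t (exp (\<i> * of_real (u / sqrt t))) t
        - \<i> * of_real (u * (\<beta> / (1 - \<alpha>)) * sqrt t))) \<longlongrightarrow> exp (of_real (- (v * u\<^sup>2 / 2)))) at_top"
      unfolding v_def using assms by (intro tendsto_exp tendsto_immigration_exponent) auto
    moreover have "exp (of_real (- (v * u\<^sup>2 / 2))) = char ?N u"
      using v by (subst char_normal_distribution) (simp_all only: exp_of_real real_sqrt_gt_0_iff real_sqrt_pow2 less_imp_le minus_divide_left)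
    ultimately have "((\<lambda>t. exp (immigration_exponent \<alpha> \<beta> \<gamma> t (exp (\<i> * of_real (u / sqrt t))) t
        - \<i> * of_real (u * (\<beta> / (1 - \<alpha>)) * sqrt t))) \<longlongrightarrow> char ?N u) at_top"
      by (simp only:)
    then show ?thesis
    proof (rule Lim_transform_eventually)
      show "\<forall>\<^sub>F t in at_top. exp (immigration_exponent \<alpha> \<beta> \<gamma> t (exp (\<i> * of_real (u / sqrt t))) t
        - \<i> * of_real (u * (\<beta> / (1 - \<alpha>)) * sqrt t)) = char (?D t) u"
        using eventually_gt_at_top[of 0] by eventually_elim (rule char_scaled_counting[symmetric])
    qed
  qed
  \<comment> \<open>Levy's continuity theorem concerns sequences, so convergence along
    \<open>at_top\<close> is tested on every sequence of times tending to infinity.\<close>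
  show ?thesis
    unfolding weak_conv_along_def v_def[symmetric]
  proof (intro allI impI tendsto_at_topI_sequentially)
    fix x and \<tau> :: "nat \<Rightarrow> real"
    assume x: "isCont (cdf ?N) x" and \<tau>: "filterlim \<tau> at_top sequentially"
    have "weak_conv_m (\<lambda>n. ?D (\<tau> n)) ?N"
      by (rule levy_continuity[OF D N filterlim_compose[OF char \<tau>]])
    then show "(\<lambda>n. cdf (?D (\<tau> n)) x) \<longlonglongrightarrow> cdf ?N x"
      using x by (simp add: weak_conv_m_def weak_conv_def)
  qed
qed

end
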